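(* Let $\mathcal{X}\subseteq\mathbb{R}^n$ be closed and convex, let $f:\mathcal{X}\to\mathbb{R}$ be a continuously differentiable convex function that is $L$-smooth with respect to a norm $\|\cdot\|$ and has a minimizer $\mathbf{x}_*\in\arg\min_{\mathbf{x}\in\mathcal{X}}f(\mathbf{x})$, and let $\mathbf{x}_0\in\mathcal{X}$ be an arbitrary initial point. Suppose the sequences $\mathbf{x}_k,\mathbf{y}_k,\mathbf{z}_k$ evolve according to the AGD+ algorithm (defined in the context) for some differentiable function $\psi:\mathcal{X}\to\mathbb{R}$ that is $\mu$-strongly convex with respect to $\|\cdot\|$ ($\mu>0$), where the oracle errors $\boldsymbol{\eta}_k$ are zero-mean independent random vectors. Let $K\ge1$ be an arbitrary but fixed number of iterations. (1) Let $b_i>0$, $\gamma=\mu\big/\max\big\{L,\sqrt{\sum_{i=1}^K b_i^2\,\mathbb{E}[\|\boldsymbol{\eta}_i\|_*^2]}\big\}$, $a_i=\gamma b_i$, and suppose $\frac{a_i^2}{A_i}\le\gamma$ for all $i$. Then $$\mathbb{E}[f(\mathbf{y}_K)-f(\mathbf{x}_* )]\le\frac{D_\psi(\mathbf{x}_*,\mathbf{x}_0)}{A_K}+\frac{\sqrt{\sum_{i=1}^K a_i^2\,\mathbb{E}[\|\boldsymbol{\eta}_i\|_*^2]}}{A_K}.$$ (2) In particular, if in (1) $b_i=\frac{i+1}{2}$ and, in addition, $\mathbb{E}[\|\boldsymbol{\eta}_i\|_*^2]\le\sigma^2$ for all $i$, then $$\mathbb{E}[f(\mathbf{y}_K)-f(\mathbf{x}_*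 )]\le\frac{4L\,D_\psi(\mathbf{x}_*,\mathbf{x}_0)}{\mu K(K+3)}+O\left(\frac{\sigma(\mu+D_\psi(\mathbf{x}_*,\mathbf{x}_0))}{\mu\sqrt{K}}\right).$$ (3) If $\mathbb{E}[\|\boldsymbol{\eta}_i\|_*^2]\le\sigma^2$ for all $i$ (with $\sigma$ possibly unknown), then setting instead $b_i=\frac{i+1}{2}$, $\gamma=\mu\big/\max\big\{L,\sqrt{\sum_{i=1}^K b_i^2}\big\}$ and $a_i=\gamma b_i$ gives $$\mathbb{E}[f(\mathbf{y}_K)-f(\mathbf{x}_* )]\le O\left(\frac{\sigma^2}{\sqrt{K}}\right)+\max\left\{\frac{4L\,D_\psi(\mathbf{x}_*,\mathbf{x}_0)}{\mu K(K+3)},\;O\left(\frac{D_\psi(\mathbf{x}_*,\mathbf{x}_0)}{\mu\sqrt{K}}\right)\right\}.$$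
   Context: The $O(\cdot)$ notation hides absolute (universal) constants. $\|\cdot\|$ is an arbitrary fixed norm on $\mathbb{R}^n$, with dual norm $\|\mathbf{z}\|_*=\sup\{\langle\mathbf{z},\mathbf{x}\rangle:\|\mathbf{x}\|=1\}$. $f$ is $L$-smooth ($L>0$) on $\mathcal{X}$ if $f(\hat{\mathbf{x}})\le f(\mathbf{x})+\langle\nabla f(\mathbf{x}),\hat{\mathbf{x}}-\mathbf{x}\rangle+\frac{L}{2}\|\hat{\mathbf{x}}-\mathbf{x}\|^2$ for all $\mathbf{x},\hat{\mathbf{x}}\in\mathcal{X}$. $\psi$ is $\mu$-strongly convex on $\mathcal{X}$ if $\psi(\hat{\mathbf{x}})\ge \psi(\mathbf{x})+\langle\nabla \psi(\mathbf{x}),\hat{\mathbf{x}}-\mathbf{x}\rangle+\frac{\mu}{2}\|\hat{\mathbf{x}}-\mathbf{x}\|^2$ for all $\mathbf{x},\hat{\mathbf{x}}\in\mathcal{X}$. Bregman divergence: $D_\psi(\mathbf{x},\hat{\mathbf{x}})=\psi(\mathbf{x})-\psi(\hat{\mathbf{x}})-\langle\nabla\psi(\hat{\mathbf{x}}),\mathbf{x}-\hat{\mathbf{x}}\rangle$. Convex conjugate: $\psi^*(\mathbf{z})=\max_{\mathbf{x}\in\mathcal{X}}\{\langle\mathbf{z},\mathbf{x}\rangle-\psi(\mathbf{x})\}$, so that $\nabla\psi^*(\mathbf{z})=\arg\max_{\mathbf{x}\in\mathcal{X}}\{\langle\mathbf{z},\mathbf{x}\rangle-\psi(\mathbf{x})\}$.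 AGD+ algorithm: let $a_k>0$ ($k\ge1$) be deterministic, $A_k=\sum_{i=1}^k a_i$, $A_0=0$. A gradient oracle queried at $\mathbf{x}_k$ returns $\widetilde{\nabla}f(\mathbf{x}_k)=\nabla f(\mathbf{x}_k)+\boldsymbol{\eta}_k$, where $\boldsymbol{\eta}_k$ is the additive error. Initialize $\mathbf{z}_0=\nabla\psi(\mathbf{x}_0)$, and set $\mathbf{x}_1=\mathbf{x}_0$, $\mathbf{z}_1=\mathbf{z}_0-a_1\widetilde{\nabla}f(\mathbf{x}_1)$, $\mathbf{y}_1=\nabla\psi^*(\mathbf{z}_1)$. For $k\ge2$: $$\mathbf{x}_k=\tfrac{A_{k-1}}{A_k}\mathbf{y}_{k-1}+\tfrac{a_k}{A_k}\nabla\psi^*(\mathbf{z}_{k-1}),\quad \mathbf{z}_k=\mathbf{z}_{k-1}-a_k\widetilde{\nabla}f(\mathbf{x}_k),\quad \mathbf{y}_k=\tfrac{A_{k-1}}{A_k}\mathbf{y}_{k-1}+\tfrac{a_k}{A_k}\nabla\psi^*(\mathbf{z}_k).$$ *)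

theory Defs
  imports "HOL-Probability.Probability"
begin

text \<open>The norm of the type \<^typ>\<open>real ^ 'n\<close> is Euclidean; an arbitrary norm on it is a
  function.\<close>

definition is_norm :: "('a::real_vector \<Rightarrow> real) \<Rightarrow> bool" where
  "is_norm N \<longleftrightarrow>
     (\<forall>x. 0 \<le> N x) \<and> (\<forall>x. N x = 0 \<longleftrightarrow> x = 0) \<and>
     (\<forall>c x. N (c *\<^sub>R x) = \<bar>c\<bar> * N x) \<and> (\<forall>x y. N (x + y) \<le> N x + N y)"

definition dual_norm :: "('a::real_inner \<Rightarrow> real) \<Rightarrow> 'a \<Rightarrow> real" where
  "dual_norm N z = (SUP x\<in>{x. N x = 1}. z \<bullet> x)"

text \<open>Functions on \<open>X\<close> are total functions of which only the values on \<open>X\<close> matter.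
  The derivative is taken within \<open>X\<close>, which may have empty interior; in that case
  \<open>g\<close> is one of several possible gradient fields.\<close>

definition has_gradient_on ::
  "('a::real_inner \<Rightarrow> real) \<Rightarrow> ('a \<Rightarrow> 'a) \<Rightarrow> 'a set \<Rightarrow> bool" where
  "has_gradient_on f g X \<longleftrightarrow>
     (\<forall>x\<in>X. (f has_derivative (\<lambda>h. g x \<bullet> h)) (at x within X))"

definition L_smooth_on ::
  "('a::real_inner \<Rightarrow> real) \<Rightarrow> real \<Rightarrow> ('a \<Rightarrow> real) \<Rightarrow> ('a \<Rightarrow> 'a) \<Rightarrow> 'a set \<Rightarrow> bool" where
  "L_smooth_on N L f g X \<longleftrightarrow>
     (\<forall>x\<in>X. \<forall>x'\<in>X. f x' \<le> f x + g x \<bullet> (x' - x) + L / 2 * (N (x' - x))\<^sup>2)"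

definition strongly_convex_on ::
  "('a::real_inner \<Rightarrow> real) \<Rightarrow> real \<Rightarrow> ('a \<Rightarrow> real) \<Rightarrow> ('a \<Rightarrow> 'a) \<Rightarrow> 'a set \<Rightarrow> bool" where
  "strongly_convex_on N \<mu> \<psi> g X \<longleftrightarrow>
     (\<forall>x\<in>X. \<forall>x'\<in>X. \<psi> x' \<ge> \<psi> x + g x \<bullet> (x' - x) + \<mu> / 2 * (N (x' - x))\<^sup>2)"

definition bregman :: "('a::real_inner \<Rightarrow> real) \<Rightarrow> ('a \<Rightarrow> 'a) \<Rightarrow> 'a \<Rightarrow> 'a \<Rightarrow> real" where
  "bregman \<psi> g x x' = \<psi> x - \<psi> x' - g x' \<bullet> (x - x')"

definition convex_conjugate :: "'a::real_inner set \<Rightarrow> ('a \<Rightarrow> real) \<Rightarrow> 'a \<Rightarrow> real" where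
  "convex_conjugate X \<psi> z = (SUP x\<in>X. z \<bullet> x - \<psi> x)"

definition grad_conjugate :: "'a::real_inner set \<Rightarrow> ('a \<Rightarrow> real) \<Rightarrow> 'a \<Rightarrow> 'a" where
  "grad_conjugate X \<psi> z = (THE v. GDERIV (convex_conjugate X \<psi>) z :> v)"

text \<open>One realisation of the AGD+ iterates: \<open>gf\<close> and \<open>g\<psi>\<close> are the gradients of the objective
  and of \<open>\<psi>\<close>, and \<open>e k\<close> is the realised oracle error. The values \<open>x 0\<close> and \<open>y 0\<close> are not
  constrained; the initial point is \<open>x0\<close>.\<close>

definition AGD_plus ::
  "'a::real_inner set \<Rightarrow> ('a \<Rightarrow> 'a) \<Rightarrow> ('a \<Rightarrow> real) \<Rightarrow> ('a \<Rightarrow> 'a) \<Rightarrow> 'a \<Rightarrow> (nat \<Rightarrow> real) \<Rightarrow>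
   (nat \<Rightarrow> 'a) \<Rightarrow> (nat \<Rightarrow> 'a) \<Rightarrow> (nat \<Rightarrow> 'a) \<Rightarrow> (nat \<Rightarrow> 'a) \<Rightarrow> bool" where
  "AGD_plus X gf \<psi> g\<psi> x0 a e x y z \<longleftrightarrow>
     (let A = (\<lambda>k. \<Sum>i=1..k. a i) in
       z 0 = g\<psi> x0 \<and>
       x 1 = x0 \<and>
       z 1 = z 0 - a 1 *\<^sub>R (gf (x 1) + e 1) \<and>
       y 1 = grad_conjugate X \<psi> (z 1) \<and>
       (\<forall>k\<ge>2.
         x k = (A (k - 1) / A k) *\<^sub>R y (k - 1) + (a k / A k) *\<^sub>R grad_conjugate X \<psi> (z (k - 1)) \<and>
         z k = z (k - 1) - a k *\<^sub>R (gf (x k) + e k) \<and>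
         y k = (A (k - 1) / A k) *\<^sub>R y (k - 1) + (a k / A k) *\<^sub>R grad_conjugate X \<psi> (z k)))"

text \<open>The Bochner integral of a non-integrable function is 0, so a bound on an expectation is
  only meaningful together with integrability.\<close>

definition expectation_le :: "'w measure \<Rightarrow> ('w \<Rightarrow> real) \<Rightarrow> real \<Rightarrow> bool" where
  "expectation_le M Y c \<longleftrightarrow> integrable M Y \<and> (\<integral>\<omega>. Y \<omega> \<partial>M) \<le> c"

text \<open>The constant hidden in every \<open>O\<close> term: a bound by \<open>O(t)\<close> is a bound by
  \<open>absolute_const * t\<close>. It is an explicit number because an existential quantifier inside
  the theorem would let the constant depend on its types, hence on the dimension.\<close>

definition absolute_const :: real where
  "absolute_const = 2"

end

theory Submission
  imports Defs
begin

text \<open>Write \<open>w z\<close> for the point of \<open>X\<close> minimising \<open>m z u = \<psi> u - z \<bullet> u\<close>; strong convexity of \<open>\<psi>\<close>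
  makes \<open>w\<close> Lipschitz with constant \<open>1 / \<mu>\<close> and identifies it with the gradient of the conjugate. For
  the potential \<open>P k = A k * (f (y k) - f xs) + m (z k) xs - m (z k) (w (z k))\<close>, smoothness and
  convexity of \<open>f\<close> and \<open>L * (a k)\<^sup>2 \<le> \<mu> * A k\<close> give
  \<open>P k \<le> P (k - 1) + a k * (\<eta> k \<bullet> (xs - w (z k)))\<close> for every realisation of the errors. The point
  \<open>w (z k)\<close> depends on \<open>\<eta> k\<close>; replacing it by the point that the exact gradient
  would have produced changes the inner product by at most \<open>a k * (dual_norm N (\<eta> k))\<^sup>2 / \<mu>\<close>, and
  after the replacement the expectation vanishes by independence. All three bounds
  follow from the resulting error \<open>D / A K + (\<Sum>i=1..K. (a i)\<^sup>2 * V i) / (\<mu> * A K)\<close> by the choice of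
  the step sizes.\<close>

subsection \<open>Norms and dual norms\<close>

locale norm_fun =
  fixes N :: "'a::euclidean_space \<Rightarrow> real"
  assumes is_norm: "is_norm N"
begin

lemma nonneg: "0 \<le> N x"
  and eq_0_iff: "N x = 0 \<longleftrightarrow> x = 0"
  and scale: "N (c *\<^sub>R x) = \<bar>c\<bar> * N x"
  and triangle: "N (x + y) \<le> N x + N y"
  using is_norm by (auto simp: is_norm_def)

lemma minus: "N (- x) = N x"
  using scale[of "-1" x] by simp

lemma diff_commute: "N (x - y) = N (y - x)"
  using minus[of "x - y"] by simp

lemma sum_le: "finite I \<Longrightarrow> N (\<Sum>i\<in>I. h i) \<le> (\<Sum>i\<in>I. N (h i))"
proof (induction I rule: finite_induct)
  case empty
  then show ?case using eq_0_iff[of 0] by simp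
next
  case (insert i I)
  then show ?case using triangle[of "h i" "\<Sum>i\<in>I. h i"] by simp
qed

text \<open>Expanding \<open>x\<close> in the basis gives one half of the equivalence of norms; it
  makes \<open>N\<close> Lipschitz, hence continuous and Borel measurable.\<close>

lemma le_norm: "\<exists>C>0. \<forall>x. N x \<le> C * norm x"
proof (intro exI conjI allI)
  let ?C = "(\<Sum>b\<in>Basis. N b) + 1"
  show "?C > 0" by (intro add_nonneg_pos sum_nonneg nonneg) simp
  fix x
  have "N x = N (\<Sum>b\<in>Basis. (x \<bullet> b) *\<^sub>R b)" by (simp add: euclidean_representation)
  also have "\<dots> \<le> (\<Sum>b\<in>Basis. \<bar>x \<bullet> b\<bar> * N b)"
    using sum_le[of Basis "\<lambda>b. (x \<bullet> b) *\<^sub>R b"] by (simp add: scale)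
  also have "\<dots> \<le> (\<Sum>b\<in>Basis. norm x * N b)"
    by (intro sum_mono mult_right_mono Basis_le_norm nonneg)
  also have "\<dots> \<le> ?C * norm x"
    by (simp add: sum_distrib_left[symmetric] distrib_left mult.commute[of _ "norm x"])
  finally show "N x \<le> ?C * norm x" .
qed

lemma continuous_on: "continuous_on S N"
proof -
  obtain C where C: "C > 0" "\<And>x. N x \<le> C * norm x" using le_norm by blast
  have "\<bar>N x - N y\<bar> \<le> C * norm (x - y)" for x y
    using triangle[of "x - y" y] triangle[of "y - x" x] C(2)[of "x - y"] diff_commute[of x y]
    by simp
  then have "C-lipschitz_on S N"
    using C(1) by (auto intro!: lipschitz_onI simp: dist_norm)
  then show ?thesis by (rule lipschitz_on_continuous_on)
qed

text \<open>\<open>N\<close> is continuous and positive on the compact Euclidean unit sphere, so it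
  has a positive minimum there; homogeneity carries it to all \<open>x\<close>.\<close>

lemma ge_norm: "\<exists>c>0. \<forall>x. c * norm x \<le> N x"
proof -
  have "sphere (0::'a) 1 \<noteq> {}" by simp
  then obtain s where s: "s \<in> sphere 0 1" "\<And>y. y \<in> sphere 0 1 \<Longrightarrow> N s \<le> N y"
    using continuous_attains_inf[OF compact_sphere _ continuous_on, of 0 1] by blast
  have "N s > 0"
    using s(1) nonneg[of s] eq_0_iff[of s] by (cases "s = 0") auto
  moreover have "N s * norm x \<le> N x" for x
  proof (cases "x = 0")
    case True
    then show ?thesis by (simp add: nonneg)
  next
    case False
    then have "N s \<le> N ((1 / norm x) *\<^sub>R x)" by (intro s(2)) simp
    then show ?thesis using False by (simp add: scale field_simps)
  qed
  ultimately show ?thesis by blast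
qed

text \<open>A supremum of reals is an upper bound only if the set is bounded above;
  \<open>ge_norm\<close> bounds the Euclidean length of the \<open>N\<close>-unit vectors.\<close>

lemma bdd_above_dual: "bdd_above ((\<lambda>x. z \<bullet> x) ` {x. N x = 1})"
proof -
  obtain c where c: "c > 0" "\<And>x. c * norm x \<le> N x" using ge_norm by blast
  have "z \<bullet> x \<le> norm z / c" if "N x = 1" for x
  proof -
    have "z \<bullet> x \<le> norm z * norm x" by (rule norm_cauchy_schwarz)
    also have "\<dots> \<le> norm z * (1 / c)"
      using c(2)[of x] c(1) that by (intro mult_left_mono) (auto simp: field_simps)
    finally show ?thesis by simp
  qed
  then show ?thesis by (auto simp: bdd_above_def)
qed

lemma inner_le_dual: "z \<bullet> x \<le> dual_norm N z * N x"
proof (cases "x = 0")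
  case False
  then have pos: "N x > 0" using nonneg[of x] eq_0_iff[of x] by linarith
  have "z \<bullet> ((1 / N x) *\<^sub>R x) \<le> dual_norm N z"
    unfolding dual_norm_def
    by (rule cSUP_upper[OF _ bdd_above_dual]) (use pos in \<open>simp add: scale\<close>)
  then show ?thesis using pos by (simp add: field_simps)
qed (use eq_0_iff[of 0] in simp)

lemma abs_inner_le_dual: "\<bar>z \<bullet> x\<bar> \<le> dual_norm N z * N x"
  using inner_le_dual[of z x] inner_le_dual[of z "- x"] by (simp add: minus)

text \<open>Bounding a supremum from above needs a nonempty set. The dimension is positive, so a
  basis vector can be normalised.\<close>

lemma unit_sphere_nonempty: "{x. N x = 1} \<noteq> {}"
proof -
  obtain b :: 'a where "b \<in> Basis" using nonempty_Basis by blast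
  then have "N b > 0" using nonneg[of b] eq_0_iff[of b] by fastforce
  then have "(1 / N b) *\<^sub>R b \<in> {x. N x = 1}" by (simp add: scale)
  then show ?thesis by blast
qed

lemma dual_nonneg: "0 \<le> dual_norm N z"
proof -
  obtain x where "N x = 1" using unit_sphere_nonempty by blast
  then show ?thesis using abs_inner_le_dual[of z x] by simp
qed

lemma dual_scale_le:
  assumes "0 \<le> c"
  shows "dual_norm N (c *\<^sub>R z) \<le> c * dual_norm N z"
  unfolding dual_norm_def[of N "c *\<^sub>R z"]
proof (rule cSUP_least[OF unit_sphere_nonempty])
  fix x assume "x \<in> {x. N x = 1}"
  then have "z \<bullet> x \<le> dual_norm N z" using inner_le_dual[of z x] by simp
  then show "(c *\<^sub>R z) \<bullet> x \<le> c * dual_norm N z" using assms by (simp add: mult_left_mono)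
qed

lemma dual_le_norm: "\<exists>C>0. \<forall>z. dual_norm N z \<le> C * norm z"
proof -
  obtain c where c: "c > 0" "\<And>x. c * norm x \<le> N x" using ge_norm by blast
  have "dual_norm N z \<le> (1 / c) * norm z" for z
    unfolding dual_norm_def
  proof (rule cSUP_least[OF unit_sphere_nonempty])
    fix x assume "x \<in> {x. N x = 1}"
    then have x: "norm x \<le> 1 / c" using c(2)[of x] c(1) by (simp add: field_simps)
    have "z \<bullet> x \<le> norm z * norm x" by (rule norm_cauchy_schwarz)
    also have "\<dots> \<le> norm z * (1 / c)" using x by (intro mult_left_mono) auto
    finally show "z \<bullet> x \<le> (1 / c) * norm z" by simp
  qed
  then show ?thesis using c(1) by (intro exI[of _ "1 / c"]) auto
qed

end

subsection \<open>Gradients\<close>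

text \<open>The derivative is taken within \<open>X\<close>, which may have empty interior, so the
  function is restricted to the segment from \<open>x\<close> to \<open>u\<close>. By convexity its
  difference quotients at 0 are at most \<open>f u - f x\<close>, and so is their limit from the
  right.\<close>

lemma convex_on_imp_above_tangent_within:
  assumes f: "convex_on X f" and g: "has_gradient_on f g X" and x: "x \<in> X" and u: "u \<in> X"
  shows "f x + g x \<bullet> (u - x) \<le> f u"
proof -
  define h where "h t = f (x + t *\<^sub>R (u - x))" for t :: real
  have seg: "x + t *\<^sub>R (u - x) \<in> X" if "t \<in> {0..1}" for t
  proof -
    have "(1 - t) *\<^sub>R x + t *\<^sub>R u \<in> X"
      using f that x u by (intro convexD) (auto simp: convex_on_def)
    then show ?thesis by (simp add: algebra_simps)
  qed
  have "(f has_derivative (\<lambda>h. g x \<bullet> h)) (at (x + 0 *\<^sub>R (u - x)) within X)"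
    using g x by (simp add: has_gradient_on_def)
  then have "(f has_derivative (\<lambda>h. g x \<bullet> h))
      (at (x + 0 *\<^sub>R (u - x)) within (\<lambda>t. x + t *\<^sub>R (u - x)) ` {0..1})"
    by (rule has_derivative_subset) (use seg in auto)
  moreover have "((\<lambda>t. x + t *\<^sub>R (u - x)) has_derivative (\<lambda>t. t *\<^sub>R (u - x)))
      (at 0 within {0..1})"
    by (auto intro!: derivative_eq_intros)
  ultimately have "(h has_derivative (\<lambda>t. g x \<bullet> (t *\<^sub>R (u - x)))) (at 0 within {0..1})"
    unfolding h_def by (rule has_derivative_in_compose[rotated])
  moreover have "(\<lambda>t. g x \<bullet> (t *\<^sub>R (u - x))) = (*) (g x \<bullet> (u - x))"
    by (simp add: fun_eq_iff)
  ultimately have "(h has_field_derivative (g x \<bullet> (u - x))) (at 0 within {0..1})"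
    unfolding has_field_derivative_def by simp
  then have lim: "((\<lambda>t. (h t - h 0) / (t - 0)) \<longlongrightarrow> g x \<bullet> (u - x)) (at 0 within {0..1})"
    by (simp add: has_field_derivative_iff)
  have "(h t - h 0) / (t - 0) \<le> f u - f x" if "t \<in> {0..1}" "t \<noteq> 0" for t
  proof -
    have "h t \<le> (1 - t) * f x + t * f u"
      using convex_onD[OF f, of t x u] that x u by (simp add: h_def algebra_simps)
    then show ?thesis using that by (simp add: h_def field_simps)
  qed
  then have "\<forall>\<^sub>F t in at 0 within {0..1}. (h t - h 0) / (t - 0) \<le> f u - f x"
    by (auto simp: eventually_at_filter)
  from tendsto_upperbound[OF lim this] show ?thesis
    by (simp add: at_within_Icc_at_right)
qed

lemma has_gradient_on_imp_continuous_on: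
  "has_gradient_on f g X \<Longrightarrow> continuous_on X f"
  unfolding has_gradient_on_def
  by (meson continuous_on_eq_continuous_within has_derivative_continuous)

subsection \<open>The gradient of the conjugate of a strongly convex function\<close>

locale mirror_map = norm_fun N for N :: "'a::euclidean_space \<Rightarrow> real" +
  fixes X :: "'a set" and \<psi> :: "'a \<Rightarrow> real" and g\<psi> :: "'a \<Rightarrow> 'a" and \<mu> :: real
  assumes closed_X: "closed X" and convex_X: "convex X" and X_nonempty: "X \<noteq> {}"
    and gradient_\<psi>: "has_gradient_on \<psi> g\<psi> X"
    and \<mu>_pos: "\<mu> > 0" and strongly_convex: "strongly_convex_on N \<mu> \<psi> g\<psi> X"
begin

lemma strongly_convexD:
  "x \<in> X \<Longrightarrow> u \<in> X \<Longrightarrow> \<psi> x + g\<psi> x \<bullet> (u - x) + \<mu> / 2 * (N (u - x))\<^sup>2 \<le> \<psi> u"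
  using strongly_convex by (auto simp: strongly_convex_on_def)

text \<open>Coercivity: strong convexity at a fixed \<open>p\<close> makes the quadratic term
  outweigh the linear one outside a ball, so a minimiser over the compact part of \<open>X\<close>
  inside the ball is global.\<close>

lemma ex_minimizer: "\<exists>v\<in>X. \<forall>u\<in>X. \<psi> v - z \<bullet> v \<le> \<psi> u - z \<bullet> u"
proof -
  obtain p where p: "p \<in> X" using X_nonempty by blast
  obtain c where c: "c > 0" "\<And>x. c * norm x \<le> N x" using ge_norm by blast
  \<comment> \<open>Beyond this radius \<open>\<mu> / 2 * (c * r)\<^sup>2\<close> exceeds
    \<open>norm (z - g\<psi> p) * r\<close>, the largest possible linear decrease.\<close>
  define R where "R = 2 * norm (z - g\<psi> p) / (\<mu> * c\<^sup>2)"
  have R0: "0 \<le> R" unfolding R_def using \<mu>_pos by simp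
  have far: "\<psi> p - z \<bullet> p \<le> \<psi> u - z \<bullet> u" if u: "u \<in> X" "u \<notin> cball p R" for u
  proof -
    let ?r = "norm (u - p)"
    have r: "?r > R" "?r > 0" using u R0 by (auto simp: dist_norm norm_minus_commute)
    have "(z - g\<psi> p) \<bullet> (u - p) \<le> norm (z - g\<psi> p) * ?r" by (rule norm_cauchy_schwarz)
    also have "norm (z - g\<psi> p) \<le> \<mu> / 2 * c\<^sup>2 * ?r"
      using r(1) \<mu>_pos c(1) by (simp add: R_def field_simps)
    then have "norm (z - g\<psi> p) * ?r \<le> \<mu> / 2 * c\<^sup>2 * ?r * ?r"
      using r by (intro mult_right_mono) auto
    also have "\<dots> = \<mu> / 2 * (c * ?r)\<^sup>2" by (simp add: power2_eq_square)
    also have "\<dots> \<le> \<mu> / 2 * (N (u - p))\<^sup>2"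
      using c \<mu>_pos by (intro mult_left_mono power_mono) auto
    finally show ?thesis
      using strongly_convexD[OF p u(1)] by (simp add: inner_diff_left inner_diff_right)
  qed
  have "compact (X \<inter> cball p R)" by (simp add: closed_X closed_Int_compact)
  moreover have pR: "p \<in> X \<inter> cball p R" using p R0 by simp
  moreover have "continuous_on (X \<inter> cball p R) (\<lambda>u. \<psi> u - z \<bullet> u)"
    by (intro continuous_intros
        continuous_on_subset[OF has_gradient_on_imp_continuous_on[OF gradient_\<psi>]]) auto
  ultimately obtain v where v: "v \<in> X \<inter> cball p R"
      "\<And>u. u \<in> X \<inter> cball p R \<Longrightarrow> \<psi> v - z \<bullet> v \<le> \<psi> u - z \<bullet> u"
    using continuous_attains_inf[of "X \<inter> cball p R" "\<lambda>u. \<psi> u - z \<bullet> u"] by blast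
  have "\<psi> v - z \<bullet> v \<le> \<psi> u - z \<bullet> u" if "u \<in> X" for u
    using v(2)[of u] v(2)[OF pR] far[of u] that by (cases "u \<in> cball p R") auto
  then show ?thesis using v(1) by blast
qed

text \<open>Strong convexity at a point \<open>w\<close> between \<open>v\<close> and
  \<open>u\<close> is used towards both ends, with weights \<open>t\<close> and \<open>1 - t\<close>
  that cancel the gradient terms. Minimality of \<open>v\<close> against \<open>w\<close> then
  leaves \<open>1 - t\<close> times the quadratic, and \<open>t\<close> tends to 0.\<close>

lemma minimizer_quadratic_growth:
  assumes v: "v \<in> X" "\<And>u. u \<in> X \<Longrightarrow> \<psi> v - z \<bullet> v \<le> \<psi> u - z \<bullet> u" and u: "u \<in> X"
  shows "\<psi> v - z \<bullet> v + \<mu> / 2 * (N (u - v))\<^sup>2 \<le> \<psi> u - z \<bullet> u"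
proof -
  let ?d = "(\<psi> u - z \<bullet> u) - (\<psi> v - z \<bullet> v)" and ?q = "\<mu> / 2 * (N (u - v))\<^sup>2"
  have bound: "(1 - t) * ?q \<le> ?d" if t: "t \<in> {0<..<1}" for t :: real
  proof -
    define w where "w = v + t *\<^sub>R (u - v)"
    have "(1 - t) *\<^sub>R v + t *\<^sub>R u \<in> X" using convex_X v(1) u t by (intro convexD) auto
    then have w: "w \<in> X" by (simp add: w_def algebra_simps)
    have uw: "u - w = (1 - t) *\<^sub>R (u - v)" and vw: "v - w = (- t) *\<^sub>R (u - v)"
      by (simp_all add: w_def algebra_simps)
    have 1: "\<psi> w + (1 - t) * (g\<psi> w \<bullet> (u - v)) + (1 - t)\<^sup>2 * ?q \<le> \<psi> u"
      using strongly_convexD[OF w u] t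
      unfolding uw scale by (simp add: power_mult_distrib mult_ac)
    have 2: "\<psi> w - t * (g\<psi> w \<bullet> (u - v)) + t\<^sup>2 * ?q \<le> \<psi> v"
      using strongly_convexD[OF w v(1)]
      unfolding vw scale by (simp add: power_mult_distrib mult_ac)
    have "\<psi> w + t * ((1 - t) * ?q)
        = t * (\<psi> w + (1 - t) * (g\<psi> w \<bullet> (u - v)) + (1 - t)\<^sup>2 * ?q)
          + (1 - t) * (\<psi> w - t * (g\<psi> w \<bullet> (u - v)) + t\<^sup>2 * ?q)"
      by (simp add: power2_eq_square field_simps)
    also have "\<dots> \<le> t * \<psi> u + (1 - t) * \<psi> v"
      using 1 2 t by (intro add_mono mult_left_mono) auto
    finally have 3: "\<psi> w + t * ((1 - t) * ?q) \<le> t * \<psi> u + (1 - t) * \<psi> v" .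
    have "z \<bullet> w = (1 - t) * (z \<bullet> v) + t * (z \<bullet> u)"
      by (simp add: w_def algebra_simps)
    then have "t * ?d = t * \<psi> u + (1 - t) * \<psi> v - z \<bullet> w - (\<psi> v - z \<bullet> v)"
      by (simp add: algebra_simps)
    then have "t * ((1 - t) * ?q) \<le> t * ?d" using 3 v(2)[OF w] by linarith
    then show ?thesis using t by simp
  qed
  have "((\<lambda>t. (1 - t) * ?q) \<longlongrightarrow> (1 - 0) * ?q) (at_right 0)"
    by (intro tendsto_intros)
  moreover have "\<forall>\<^sub>F t in at_right 0. (1 - t) * ?q \<le> ?d"
    using eventually_at_right_real[of 0 "1::real"] bound by (auto elim!: eventually_mono)
  ultimately have "(1 - 0) * ?q \<le> ?d" by (rule tendsto_upperbound) simp
  then show ?thesis by simp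
qed

text \<open>The conjugate lies between the affine function given by the competitor \<open>v\<close>
  and the same function plus a quadratic centred at \<open>z\<close>, so it is differentiable there.
  The upper bound comes from the quadratic growth around \<open>v\<close>.\<close>

lemma GDERIV_convex_conjugate:
  assumes v: "v \<in> X" "\<And>u. u \<in> X \<Longrightarrow> \<psi> v - z \<bullet> v \<le> \<psi> u - z \<bullet> u"
  shows "GDERIV (convex_conjugate X \<psi>) z :> v"
proof -
  obtain C where C: "C > 0" "\<And>z. dual_norm N z \<le> C * norm z" using dual_le_norm by blast
  have upper: "z' \<bullet> u - \<psi> u \<le> z \<bullet> v - \<psi> v + (z' - z) \<bullet> v + C\<^sup>2 * (norm (z' - z))\<^sup>2 / (2 * \<mu>)"
    if "u \<in> X" for u z'
  proof -
    let ?n = "N (u - v)" and ?d = "dual_norm N (z' - z)"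
    \<comment> \<open>Young's inequality, weighted so that the square of \<open>?n\<close> has
      exactly the coefficient of the growth bound.\<close>
    have "0 \<le> (\<mu> * ?n - ?d)\<^sup>2 / (2 * \<mu>)" using \<mu>_pos by simp
    also have "\<dots> = \<mu> / 2 * ?n\<^sup>2 + ?d\<^sup>2 / (2 * \<mu>) - ?d * ?n"
      using \<mu>_pos by (simp add: power2_eq_square field_simps)
    finally have "?d * ?n \<le> \<mu> / 2 * ?n\<^sup>2 + ?d\<^sup>2 / (2 * \<mu>)" by simp
    moreover have "?d\<^sup>2 / (2 * \<mu>) \<le> (C * norm (z' - z))\<^sup>2 / (2 * \<mu>)"
      using C(2) dual_nonneg \<mu>_pos by (intro divide_right_mono power_mono) auto
    moreover have "(z' - z) \<bullet> (u - v) \<le> ?d * ?n" by (rule inner_le_dual)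
    ultimately show ?thesis
      using minimizer_quadratic_growth[OF v that]
      by (simp add: power_mult_distrib inner_diff_left inner_diff_right)
  qed
  have sup_le: "convex_conjugate X \<psi> z'
      \<le> z \<bullet> v - \<psi> v + (z' - z) \<bullet> v + C\<^sup>2 * (norm (z' - z))\<^sup>2 / (2 * \<mu>)" for z'
    unfolding convex_conjugate_def using X_nonempty upper by (intro cSUP_least)
  \<comment> \<open>\<open>upper\<close> also supplies the boundedness without which the supremum
    would dominate nothing.\<close>
  have sup_ge: "z' \<bullet> v - \<psi> v \<le> convex_conjugate X \<psi> z'" for z'
    unfolding convex_conjugate_def
    by (rule cSUP_upper[OF v(1)]) (use upper[of _ z'] in \<open>auto simp: bdd_above_def\<close>)
  have at_z: "convex_conjugate X \<psi> z = z \<bullet> v - \<psi> v"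
    using sup_le[of z] sup_ge[of z] by simp
  show ?thesis
    unfolding gderiv_def
  proof (rule has_derivativeI_sandwich[of 1])
    fix z' :: 'a assume "z' \<noteq> z"
    then have "norm (z' - z) > 0" by simp
    moreover have "norm (convex_conjugate X \<psi> z' - convex_conjugate X \<psi> z - (z' - z) \<bullet> v)
        \<le> C\<^sup>2 * (norm (z' - z))\<^sup>2 / (2 * \<mu>)"
      using sup_le[of z'] sup_ge[of z'] by (simp add: at_z inner_diff_left abs_le_iff)
    ultimately show "norm (convex_conjugate X \<psi> z' - convex_conjugate X \<psi> z - (z' - z) \<bullet> v)
        / norm (z' - z) \<le> C\<^sup>2 * norm (z' - z) / (2 * \<mu>)"
      by (simp add: divide_le_eq power2_eq_square mult_ac)
  next
    have "((\<lambda>z'. C\<^sup>2 * norm (z' - z) / (2 * \<mu>)) \<longlongrightarrow> C\<^sup>2 * norm (z - z) / (2 * \<mu>)) (at z)"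
      using \<mu>_pos by (intro tendsto_intros) auto
    then show "((\<lambda>z'. C\<^sup>2 * norm (z' - z) / (2 * \<mu>)) \<longlongrightarrow> 0) (at z)" by simp
  qed (simp_all add: bounded_linear_inner_left)
qed

text \<open>Resolves the definite description: the conjugate is differentiated in the whole space,
  where a gradient is unique.\<close>

lemma grad_conjugate_eq:
  assumes "v \<in> X" "\<And>u. u \<in> X \<Longrightarrow> \<psi> v - z \<bullet> v \<le> \<psi> u - z \<bullet> u"
  shows "grad_conjugate X \<psi> z = v"
  unfolding grad_conjugate_def
proof (rule the_equality)
  show deriv: "GDERIV (convex_conjugate X \<psi>) z :> v" using assms by (rule GDERIV_convex_conjugate)
  fix v' assume "GDERIV (convex_conjugate X \<psi>) z :> v'"
  then have "(\<lambda>h. h \<bullet> v') = (\<lambda>h. h \<bullet> v)"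
    using deriv unfolding gderiv_def by (rule has_derivative_unique)
  then show "v' = v" by (metis vector_eq_ldot)
qed

lemma grad_conjugate_in: "grad_conjugate X \<psi> z \<in> X"
  and grad_conjugate_min: "u \<in> X \<Longrightarrow> \<psi> (grad_conjugate X \<psi> z) - z \<bullet> grad_conjugate X \<psi> z
      + \<mu> / 2 * (N (u - grad_conjugate X \<psi> z))\<^sup>2 \<le> \<psi> u - z \<bullet> u"
proof -
  obtain v where v: "v \<in> X" "\<And>u. u \<in> X \<Longrightarrow> \<psi> v - z \<bullet> v \<le> \<psi> u - z \<bullet> u"
    using ex_minimizer by blast
  note eq = grad_conjugate_eq[OF v]
  show "grad_conjugate X \<psi> z \<in> X" using v(1) eq by simp
  show "\<psi> (grad_conjugate X \<psi> z) - z \<bullet> grad_conjugate X \<psi> z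
      + \<mu> / 2 * (N (u - grad_conjugate X \<psi> z))\<^sup>2 \<le> \<psi> u - z \<bullet> u" if "u \<in> X"
    using minimizer_quadratic_growth[OF v that] eq by simp
qed

text \<open>By strong convexity \<open>x\<close> itself minimises the objective with slope
  \<open>g\<psi> x\<close>. At \<open>x0\<close> this makes the first step an instance of the
  general recursion.\<close>

lemma grad_conjugate_gradient: "x \<in> X \<Longrightarrow> grad_conjugate X \<psi> (g\<psi> x) = x"
proof (rule grad_conjugate_eq)
  fix u assume x: "x \<in> X" and u: "u \<in> X"
  have "0 \<le> \<mu> / 2 * (N (u - x))\<^sup>2" using \<mu>_pos by simp
  then show "\<psi> x - g\<psi> x \<bullet> x \<le> \<psi> u - g\<psi> x \<bullet> u"
    using strongly_convexD[OF x u] by (simp add: inner_diff_right)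
qed

text \<open>Each point minimises its own objective; adding the two growth bounds, each evaluated at
  the other point, leaves \<open>\<mu>\<close> times the squared distance against a pairing with
  \<open>z - z'\<close>.\<close>

lemma grad_conjugate_lipschitz:
  "N (grad_conjugate X \<psi> z - grad_conjugate X \<psi> z') \<le> dual_norm N (z - z') / \<mu>"
proof -
  let ?v = "grad_conjugate X \<psi> z" and ?v' = "grad_conjugate X \<psi> z'"
  let ?n = "N (?v - ?v')"
  have "\<mu> * ?n\<^sup>2 \<le> (z - z') \<bullet> (?v - ?v')"
    using grad_conjugate_min[OF grad_conjugate_in, of z z']
      grad_conjugate_min[OF grad_conjugate_in, of z' z] diff_commute[of ?v ?v']
    by (simp add: inner_diff_left inner_diff_right)
  also have "\<dots> \<le> dual_norm N (z - z') * ?n" by (rule inner_le_dual)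
  finally have *: "(\<mu> * ?n) * ?n \<le> dual_norm N (z - z') * ?n"
    by (simp add: power2_eq_square mult_ac)
  show ?thesis
  proof (cases "?n = 0")
    case True
    then show ?thesis using dual_nonneg \<mu>_pos by simp
  next
    case False
    then have "?n > 0" using nonneg[of "?v - ?v'"] by linarith
    then have "\<mu> * ?n \<le> dual_norm N (z - z')" using * by simp
    then show ?thesis using \<mu>_pos by (simp add: field_simps)
  qed
qed

lemma continuous_on_grad_conjugate: "continuous_on S (grad_conjugate X \<psi>)"
proof -
  obtain c where c: "c > 0" "\<And>x. c * norm x \<le> N x" using ge_norm by blast
  obtain C where C: "C > 0" "\<And>z. dual_norm N z \<le> C * norm z" using dual_le_norm by blast
  have "norm (grad_conjugate X \<psi> z - grad_conjugate X \<psi> z') \<le> C / (\<mu> * c) * norm (z - z')" for z z'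
  proof -
    have "c * norm (grad_conjugate X \<psi> z - grad_conjugate X \<psi> z') \<le> dual_norm N (z - z') / \<mu>"
      using c(2) grad_conjugate_lipschitz order_trans by blast
    also have "\<dots> \<le> C * norm (z - z') / \<mu>" using C(2) \<mu>_pos by (intro divide_right_mono) auto
    finally show ?thesis using c(1) \<mu>_pos by (simp add: field_simps)
  qed
  then have "(C / (\<mu> * c))-lipschitz_on S (grad_conjugate X \<psi>)"
    using C(1) c(1) \<mu>_pos by (auto intro!: lipschitz_onI simp: dist_norm)
  then show ?thesis by (rule lipschitz_on_continuous_on)
qed

lemma bregman_nonneg: "x \<in> X \<Longrightarrow> u \<in> X \<Longrightarrow> 0 \<le> bregman \<psi> g\<psi> u x"
proof -
  assume "x \<in> X" "u \<in> X"
  moreover have "0 \<le> \<mu> / 2 * (N (u - x))\<^sup>2" using \<mu>_pos by simp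
  ultimately show ?thesis using strongly_convexD[of x u] by (simp add: bregman_def)
qed

end

subsection \<open>One step of the method\<close>

locale agd_problem = mirror_map N X \<psi> g\<psi> \<mu>
  for N :: "'a::euclidean_space \<Rightarrow> real" and X \<psi> g\<psi> \<mu> +
  fixes f :: "'a \<Rightarrow> real" and gf :: "'a \<Rightarrow> 'a" and L :: real and x0 xs :: 'a
  assumes convex_f: "convex_on X f" and gradient_f: "has_gradient_on f gf X"
    and continuous_gf: "continuous_on X gf" and smooth_f: "L_smooth_on N L f gf X"
    and minimizer: "is_arg_min f (\<lambda>x. x \<in> X) xs" and x0_in: "x0 \<in> X"
begin

lemma xs_in: "xs \<in> X" and f_ge: "x \<in> X \<Longrightarrow> f xs \<le> f x"
  using minimizer by (auto simp: is_arg_min_def not_less[symmetric])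

abbreviation mirror :: "'a \<Rightarrow> 'a" where
  "mirror \<equiv> grad_conjugate X \<psi>"

text \<open>The Fenchel-Young gap of \<open>\<psi>\<close> at \<open>xs\<close> and
  \<open>z\<close>, with the conjugate evaluated at its maximiser. It plays the role of a Bregman
  distance from \<open>xs\<close> to \<open>mirror z\<close>.\<close>

definition gap :: "'a \<Rightarrow> real" where
  "gap z = (\<psi> xs - z \<bullet> xs) - (\<psi> (mirror z) - z \<bullet> mirror z)"

lemma gap_ge: "\<mu> / 2 * (N (xs - mirror z))\<^sup>2 \<le> gap z"
  using grad_conjugate_min[OF xs_in, of z] by (simp add: gap_def)

lemma gap_gradient_x0: "gap (g\<psi> x0) = bregman \<psi> g\<psi> xs x0"
  by (simp add: gap_def bregman_def grad_conjugate_gradient[OF x0_in] inner_diff_right)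

text \<open>\<^const>\<open>AGD_plus\<close> leaves \<open>y 0\<close> free; the value \<open>x0\<close> makes the recursion for
  \<open>k \<ge> 2\<close> valid for \<open>k = 1\<close> as well, because \<open>A 0 = 0\<close>.\<close>

definition init :: "(nat \<Rightarrow> 'a) \<Rightarrow> nat \<Rightarrow> 'a" where
  "init y k = (if k = 0 then x0 else y k)"

definition potential :: "(nat \<Rightarrow> real) \<Rightarrow> (nat \<Rightarrow> 'a) \<Rightarrow> (nat \<Rightarrow> 'a) \<Rightarrow> nat \<Rightarrow> real" where
  "potential a y z k = (\<Sum>i=1..k. a i) * (f (init y k) - f xs) + gap (z k)"

lemma convex_step_in:
  assumes "0 \<le> A" "0 < (a::real)" "y \<in> X" "w \<in> X"
  shows "(A / (A + a)) *\<^sub>R y + (a / (A + a)) *\<^sub>R w \<in> X"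
  using convex_X assms by (intro convexD) (auto simp: add_divide_distrib[symmetric])

text \<open>\<open>y'\<close> and \<open>x\<close> differ only in the mirror point, so their
  displacement is that of the mirror points scaled by \<open>a / (A + a)\<close>. The quadratic
  error of smoothness is thereby paid by the quadratic growth of the mirror objective around
  \<open>mirror z\<close>.\<close>

lemma potential_step:
  fixes y z e :: 'a and A a :: real
  assumes A: "0 \<le> A" and a: "0 < a" and step: "L * a\<^sup>2 \<le> \<mu> * (A + a)" and y: "y \<in> X"
  defines "x \<equiv> (A / (A + a)) *\<^sub>R y + (a / (A + a)) *\<^sub>R mirror z"
  defines "z' \<equiv> z - a *\<^sub>R (gf x + e)"
  defines "y' \<equiv> (A / (A + a)) *\<^sub>R y + (a / (A + a)) *\<^sub>R mirror z'"
  shows "(A + a) * (f y' - f xs) + gap z'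
    \<le> A * (f y - f xs) + gap z + a * (e \<bullet> (xs - mirror z'))"
proof -
  define B w w' q where "B = A + a" and "w = mirror z" and "w' = mirror z'"
    and "q = (N (w' - w))\<^sup>2"
  have B: "B > 0" using A a by (simp add: B_def)
  have q: "0 \<le> q" by (simp add: q_def)
  have x: "x \<in> X" and y': "y' \<in> X"
    unfolding x_def y'_def using A a y grad_conjugate_in by (auto intro: convex_step_in)
  have Bx: "B * (v \<bullet> x) = A * (v \<bullet> y) + a * (v \<bullet> w)" for v
    using B by (simp add: x_def w_def B_def[symmetric] inner_add_right field_simps)
  have By': "B * (v \<bullet> y') = A * (v \<bullet> y) + a * (v \<bullet> w')" for v
    using B by (simp add: y'_def w'_def B_def[symmetric] inner_add_right field_simps)
  have "y' - x = (a / B) *\<^sub>R (w' - w)"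
    by (simp add: x_def y'_def w_def w'_def B_def algebra_simps)
  then have Nq: "(N (y' - x))\<^sup>2 = (a / B)\<^sup>2 * q"
    using a B by (simp add: scale q_def power_mult_distrib power_divide)
  have "f y' \<le> f x + gf x \<bullet> (y' - x) + L / 2 * ((a / B)\<^sup>2 * q)"
    using smooth_f x y' unfolding L_smooth_on_def Nq[symmetric] by blast
  then have "B * f y' \<le> B * (f x + gf x \<bullet> (y' - x) + L / 2 * ((a / B)\<^sup>2 * q))"
    using B by (intro mult_left_mono) auto
  also have "\<dots> = B * f x + A * (gf x \<bullet> y) + a * (gf x \<bullet> w') - B * (gf x \<bullet> x)
      + (L * a\<^sup>2 / B) / 2 * q"
  proof -
    have "B * (L / 2 * ((a / B)\<^sup>2 * q)) = (L * a\<^sup>2 / B) / 2 * q"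
      using B by (simp add: power2_eq_square)
    then show ?thesis
      by (simp add: By'[of "gf x", symmetric] inner_diff_right distrib_left right_diff_distrib)
  qed
  \<comment> \<open>The step-size condition enters here and matches the error to the growth term in
    \<open>4\<close>.\<close>
  also have "(L * a\<^sup>2 / B) / 2 * q \<le> \<mu> / 2 * q"
    using step B q by (intro mult_right_mono) (auto simp: B_def field_simps)
  finally have 1: "B * f y' \<le> B * f x + A * (gf x \<bullet> y) + a * (gf x \<bullet> w') - B * (gf x \<bullet> x)
      + \<mu> / 2 * q" by simp
  \<comment> \<open>Tangents at \<open>x\<close> towards \<open>y\<close> and \<open>xs\<close>,
    weighted by \<open>A\<close> and \<open>a\<close>: the weights sum to \<open>B\<close>, so
    together they eliminate the values at \<open>x\<close> from \<open>1\<close>.\<close>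
  have 2: "A * (f x + gf x \<bullet> (y - x)) \<le> A * f y"
    using A convex_on_imp_above_tangent_within[OF convex_f gradient_f x y]
    by (intro mult_left_mono)
  have 3: "a * (f x + gf x \<bullet> (xs - x)) \<le> a * f xs"
    using a convex_on_imp_above_tangent_within[OF convex_f gradient_f x xs_in]
    by (intro mult_left_mono) auto
  have 4: "\<psi> w - z \<bullet> w + \<mu> / 2 * q \<le> \<psi> w' - z \<bullet> w'"
    using grad_conjugate_min[OF grad_conjugate_in, of z z'] by (simp add: w_def w'_def q_def)
  have 5: "B * f y' \<le> A * f y + a * f xs - a * (gf x \<bullet> (xs - w')) + \<mu> / 2 * q"
    using 1 2 3 by (simp add: B_def algebra_simps)
  have zv: "z' \<bullet> v = z \<bullet> v - a * (gf x \<bullet> v) - a * (e \<bullet> v)" for v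
    by (simp add: z'_def algebra_simps)
  \<comment> \<open>Added to \<open>5\<close>, this cancels both the exact gradient term and the
    quadratic; of the update of \<open>z\<close> only the error \<open>e\<close> survives.\<close>
  have 6: "gap z' - gap z
      \<le> a * (gf x \<bullet> (xs - w')) + a * (e \<bullet> (xs - w')) - \<mu> / 2 * q"
    using 4 zv[of xs] zv[of w']
    by (simp add: gap_def w_def[symmetric] w'_def[symmetric] algebra_simps)
  show ?thesis
    using 5 6 unfolding B_def[symmetric] w'_def[symmetric] by (simp add: B_def algebra_simps)
qed

end

subsection \<open>Deterministic analysis of a run\<close>

locale agd_run = agd_problem N X \<psi> g\<psi> \<mu> f gf L x0 xs
  for N :: "'a::euclidean_space \<Rightarrow> real" and X \<psi> g\<psi> \<mu> f gf L x0 xs +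
  fixes a :: "nat \<Rightarrow> real" and e x y z :: "nat \<Rightarrow> 'a" and K :: nat
  assumes run: "AGD_plus X gf \<psi> g\<psi> x0 a e x y z"
    and a_pos: "i \<in> {1..K} \<Longrightarrow> 0 < a i"
begin

abbreviation A :: "nat \<Rightarrow> real" where
  "A k \<equiv> \<Sum>i=1..k. a i"

lemma A_nonneg: "k \<le> K \<Longrightarrow> 0 \<le> A k"
  by (intro sum_nonneg less_imp_le a_pos) auto

lemma A_Suc: "A (Suc k) = A k + a (Suc k)"
  by simp

lemma z_0: "z 0 = g\<psi> x0"
  using run by (simp add: AGD_plus_def Let_def)

lemma
  assumes k: "Suc k \<le> K"
  shows x_Suc: "x (Suc k) = (A k / (A k + a (Suc k))) *\<^sub>R init y k
      + (a (Suc k) / (A k + a (Suc k))) *\<^sub>R mirror (z k)" (is ?x)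
    and z_Suc: "z (Suc k) = z k - a (Suc k) *\<^sub>R (gf (x (Suc k)) + e (Suc k))" (is ?z)
    and y_Suc: "init y (Suc k) = (A k / (A k + a (Suc k))) *\<^sub>R init y k
      + (a (Suc k) / (A k + a (Suc k))) *\<^sub>R mirror (z (Suc k))" (is ?y)
proof -
  have "?x \<and> ?z \<and> ?y"
  proof (cases "k = 0")
    case True
    \<comment> \<open>The quotient \<open>a 1 / (0 + a 1)\<close> is 1 only for a nonzero weight. As
      \<open>mirror (z 0)\<close> is \<open>x0\<close>, the formulas then reduce to the prescribed
      first step.\<close>
    moreover have "a 1 \<noteq> 0" using a_pos[of 1] k by simp
    ultimately show ?thesis
      using run by (auto simp: AGD_plus_def Let_def init_def grad_conjugate_gradient x0_in)
  next
    case False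
    then have "2 \<le> Suc k" by simp
    then show ?thesis
      using run False by (auto simp: AGD_plus_def Let_def init_def)
  qed
  then show ?x ?z ?y by auto
qed

lemma init_y_in: "k \<le> K \<Longrightarrow> init y k \<in> X"
proof (induction k)
  case 0
  then show ?case by (simp add: init_def x0_in)
next
  case (Suc k)
  then show ?case
    using A_nonneg[of k] a_pos[of "Suc k"] grad_conjugate_in
    unfolding y_Suc[OF Suc.prems] by (intro convex_step_in) auto
qed

lemma x_in: "Suc k \<le> K \<Longrightarrow> x (Suc k) \<in> X"
  using A_nonneg[of k] a_pos[of "Suc k"] grad_conjugate_in init_y_in[of k]
  by (subst x_Suc) (auto intro!: convex_step_in)

lemma potential_0: "potential a y z 0 = bregman \<psi> g\<psi> xs x0"
  by (simp add: potential_def z_0 gap_gradient_x0)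

text \<open>Both summands of the potential are nonnegative, so either may be dropped: one bound
  yields the final error, the other the second moments.\<close>

lemma potential_ge:
  assumes "k \<le> K"
  shows "A k * (f (init y k) - f xs) \<le> potential a y z k"
    and "\<mu> / 2 * (N (xs - mirror (z k)))\<^sup>2 \<le> potential a y z k"
proof -
  have "0 \<le> \<mu> / 2 * (N (xs - mirror (z k)))\<^sup>2" using \<mu>_pos by simp
  moreover have "0 \<le> A k * (f (init y k) - f xs)"
    using A_nonneg[OF assms] f_ge[OF init_y_in[OF assms]] by simp
  ultimately show "A k * (f (init y k) - f xs) \<le> potential a y z k"
    and "\<mu> / 2 * (N (xs - mirror (z k)))\<^sup>2 \<le> potential a y z k"
    using gap_ge[of "z k"] by (simp_all add: potential_def)
qed

lemma potential_Suc:
  assumes k: "Suc k \<le> K" and step: "L * (a (Suc k))\<^sup>2 \<le> \<mu> * A (Suc k)"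
  shows "potential a y z (Suc k)
    \<le> potential a y z k + a (Suc k) * (e (Suc k) \<bullet> (xs - mirror (z (Suc k))))"
proof -
  have "0 \<le> A k" "0 < a (Suc k)" "L * (a (Suc k))\<^sup>2 \<le> \<mu> * (A k + a (Suc k))" "init y k \<in> X"
    using A_nonneg a_pos init_y_in k step unfolding A_Suc by auto
  then show ?thesis
    unfolding potential_def A_Suc x_Suc[OF k] z_Suc[OF k] y_Suc[OF k] by (rule potential_step)
qed

text \<open>AM-GM absorbs the noise term into the quadratic lower bound \<open>potential_ge\<close>, so the second
  moments of the iterates are controlled by the noise alone, without any growth
  condition on \<open>gf\<close>.\<close>

lemma potential_Suc_le_double:
  assumes k: "Suc k \<le> K" and step: "L * (a (Suc k))\<^sup>2 \<le> \<mu> * A (Suc k)"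
  shows "potential a y z (Suc k) \<le> 2 * potential a y z k + 2 * (a (Suc k))\<^sup>2 * (dual_norm N (e (Suc k)))\<^sup>2 / \<mu>"
proof -
  let ?n = "N (xs - mirror (z (Suc k)))" and ?d = "dual_norm N (e (Suc k))" and ?a = "a (Suc k)"
  have "?a * (e (Suc k) \<bullet> (xs - mirror (z (Suc k)))) \<le> ?a * (?d * ?n)"
    using a_pos[of "Suc k"] k by (intro mult_left_mono inner_le_dual) auto
  \<comment> \<open>The coefficient is half of that in \<open>potential_ge\<close>, so half of the
    new potential absorbs the square; hence the factor 2.\<close>
  also have "\<dots> \<le> \<mu> / 4 * ?n\<^sup>2 + ?a\<^sup>2 * ?d\<^sup>2 / \<mu>"
  proof -
    have "0 \<le> (\<mu> * ?n - 2 * ?a * ?d)\<^sup>2 / (4 * \<mu>)" using \<mu>_pos by simp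
    also have "\<dots> = \<mu> / 4 * ?n\<^sup>2 + ?a\<^sup>2 * ?d\<^sup>2 / \<mu> - ?a * (?d * ?n)"
      using \<mu>_pos by (simp add: power2_eq_square field_simps)
    finally show ?thesis by simp
  qed
  finally show ?thesis
    using potential_Suc[OF assms] potential_ge(2)[OF k] by simp
qed

end

subsection \<open>Independence\<close>

context prob_space
begin

text \<open>In coordinates the inner product is a finite sum of products of independent real
  variables, for which integrability of the factors suffices.\<close>

lemma indep_var_inner_integral:
  fixes Y U :: "'a \<Rightarrow> 'b::euclidean_space"
  assumes ind: "indep_var borel Y borel U" and Y: "integrable M Y" and U: "integrable M U"
  shows "integrable M (\<lambda>\<omega>. Y \<omega> \<bullet> U \<omega>)"
    and "(\<integral>\<omega>. Y \<omega> \<bullet> U \<omega> \<partial>M) = (\<integral>\<omega>. Y \<omega> \<partial>M) \<bullet> (\<integral>\<omega>. U \<omega> \<partial>M)"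
proof -
  have ind_b: "indep_var borel (\<lambda>\<omega>. Y \<omega> \<bullet> b) borel (\<lambda>\<omega>. U \<omega> \<bullet> b)" for b
    using indep_var_compose[OF ind, of "\<lambda>v. v \<bullet> b" borel "\<lambda>v. v \<bullet> b" borel]
    by (simp add: comp_def)
  have int: "integrable M (\<lambda>\<omega>. Y \<omega> \<bullet> b)" "integrable M (\<lambda>\<omega>. U \<omega> \<bullet> b)" for b
    using Y U by auto
  note prod_int = indep_var_integrable[OF ind_b int]
  have eq: "Y \<omega> \<bullet> U \<omega> = (\<Sum>b\<in>Basis. (Y \<omega> \<bullet> b) * (U \<omega> \<bullet> b))" for \<omega>
    by (rule euclidean_inner)
  show "integrable M (\<lambda>\<omega>. Y \<omega> \<bullet> U \<omega>)"
    unfolding eq by (intro Bochner_Integration.integrable_sum prod_int)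
  have "(\<integral>\<omega>. Y \<omega> \<bullet> U \<omega> \<partial>M) = (\<Sum>b\<in>Basis. (\<integral>\<omega>. (Y \<omega> \<bullet> b) * (U \<omega> \<bullet> b) \<partial>M))"
    unfolding eq by (intro Bochner_Integration.integral_sum prod_int)
  also have "\<dots> = (\<Sum>b\<in>Basis. ((\<integral>\<omega>. Y \<omega> \<partial>M) \<bullet> b) * ((\<integral>\<omega>. U \<omega> \<partial>M) \<bullet> b))"
    using indep_var_lebesgue_integral[OF ind_b int] Y U by simp
  also have "\<dots> = (\<integral>\<omega>. Y \<omega> \<partial>M) \<bullet> (\<integral>\<omega>. U \<omega> \<partial>M)"
    by (rule euclidean_inner[symmetric])
  finally show "(\<integral>\<omega>. Y \<omega> \<bullet> U \<omega> \<partial>M) = (\<integral>\<omega>. Y \<omega> \<partial>M) \<bullet> (\<integral>\<omega>. U \<omega> \<partial>M)" .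
qed

text \<open>Independence concerns generated sigma-algebras and passes to anything measurable for
  them. This covers iterates, which are given by a recursion and not as explicit functions of the
  errors.\<close>

lemma indep_var_vimage_algebra:
  assumes ind: "indep_var S V T W"
    and Y: "Y \<in> vimage_algebra (space M) V S \<rightarrow>\<^sub>M Q"
    and U: "U \<in> vimage_algebra (space M) W T \<rightarrow>\<^sub>M R"
  shows "indep_var Q Y R U"
proof -
  have *: "Z \<in> M \<rightarrow>\<^sub>M P' \<and> sigma_sets (space M) {Z -` A \<inter> space M |A. A \<in> sets P'}
      \<subseteq> sigma_sets (space M) {W' -` A \<inter> space M |A. A \<in> sets T'}"
    if W: "W' \<in> M \<rightarrow>\<^sub>M T'" and Z: "Z \<in> vimage_algebra (space M) W' T' \<rightarrow>\<^sub>M P'"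
    for Z :: "'a \<Rightarrow> 'd" and P' and W' :: "'a \<Rightarrow> 'e" and T'
  proof
    have "sets (vimage_algebra (space M) W' T') \<subseteq> sets M"
      using W by (intro sets_image_in_sets) auto
    then show "Z \<in> M \<rightarrow>\<^sub>M P'"
      using Z by (auto simp: measurable_def)
    have "Z -` A \<inter> space M \<in> sets (vimage_algebra (space M) W' T')" if "A \<in> sets P'" for A
      using measurable_sets[OF Z that] by simp
    then show "sigma_sets (space M) {Z -` A \<inter> space M |A. A \<in> sets P'}
        \<subseteq> sigma_sets (space M) {W' -` A \<inter> space M |A. A \<in> sets T'}"
      unfolding sets_vimage_algebra by (intro sigma_sets_mono) auto
  qed
  from *[OF indep_var_rv1[OF ind] Y] *[OF indep_var_rv2[OF ind] U] show ?thesis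
    using ind unfolding indep_var_eq indep_sets2_eq by blast
qed

end

subsection \<open>The expected error\<close>

locale agd_stochastic = agd_problem N X \<psi> g\<psi> \<mu> f gf L x0 xs + prob_space M
  for N :: "'a::euclidean_space \<Rightarrow> real" and X \<psi> g\<psi> \<mu> f gf L x0 xs
    and M :: "'w measure" +
  fixes a :: "nat \<Rightarrow> real" and \<eta> x y z :: "nat \<Rightarrow> 'w \<Rightarrow> 'a" and K :: nat
  assumes runs: "\<omega> \<in> space M \<Longrightarrow> AGD_plus X gf \<psi> g\<psi> x0 a
      (\<lambda>k. \<eta> k \<omega>) (\<lambda>k. x k \<omega>) (\<lambda>k. y k \<omega>) (\<lambda>k. z k \<omega>)"
    and a_pos: "i \<in> {1..K} \<Longrightarrow> 0 < a i"
    and step: "i \<in> {1..K} \<Longrightarrow> L * (a i)\<^sup>2 \<le> \<mu> * (\<Sum>j=1..i. a j)"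
    and K_pos: "1 \<le> K"
    and indep: "indep_vars (\<lambda>_. borel) \<eta> {1..K}"
    and integrable_\<eta>: "i \<in> {1..K} \<Longrightarrow> integrable M (\<eta> i)"
    and mean_\<eta>: "i \<in> {1..K} \<Longrightarrow> (\<integral>\<omega>. \<eta> i \<omega> \<partial>M) = 0"
    and integrable_dual: "i \<in> {1..K} \<Longrightarrow> integrable M (\<lambda>\<omega>. (dual_norm N (\<eta> i \<omega>))\<^sup>2)"
begin

abbreviation Y :: "nat \<Rightarrow> 'w \<Rightarrow> 'a" where
  "Y k \<omega> \<equiv> init (\<lambda>k. y k \<omega>) k"

abbreviation P :: "nat \<Rightarrow> 'w \<Rightarrow> real" where
  "P k \<omega> \<equiv> potential a (\<lambda>k. y k \<omega>) (\<lambda>k. z k \<omega>) k"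

lemma agd_run:
  "\<omega> \<in> space M \<Longrightarrow> agd_run N X \<psi> g\<psi> \<mu> f gf L x0 xs a
    (\<lambda>k. \<eta> k \<omega>) (\<lambda>k. x k \<omega>) (\<lambda>k. y k \<omega>) (\<lambda>k. z k \<omega>) K"
  by (intro agd_run.intro agd_run_axioms.intro agd_problem_axioms runs a_pos)

section \<open>Measurability of the iterates and independence from later errors\<close>

lemma measurable_\<eta>: "i \<in> {1..K} \<Longrightarrow> \<eta> i \<in> borel_measurable M"
  using integrable_\<eta> by auto

text \<open>\<open>f\<close> and \<open>gf\<close> are continuous on \<open>X\<close> only, so
  measurability goes through the Borel structure restricted to \<open>X\<close>, where the iterates
  lie.\<close>

lemma measurable_continuous_on_X:
  fixes h :: "'a \<Rightarrow> 'b::topological_space"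
  assumes "continuous_on X h" "u \<in> borel_measurable G" "\<And>\<omega>. \<omega> \<in> space G \<Longrightarrow> u \<omega> \<in> X"
  shows "(\<lambda>\<omega>. h (u \<omega>)) \<in> borel_measurable G"
proof -
  have u: "u \<in> G \<rightarrow>\<^sub>M restrict_space borel X"
    using assms(2,3) by (intro measurable_restrict_space2) auto
  have h: "h \<in> borel_measurable (restrict_space borel X)"
    using assms(1) by (rule borel_measurable_continuous_on_restrict)
  show ?thesis using measurable_compose[OF u h] .
qed

lemma measurable_mirror:
  "u \<in> borel_measurable G \<Longrightarrow> (\<lambda>\<omega>. mirror (u \<omega>)) \<in> borel_measurable G"
  by (rule measurable_compose[OF _ borel_measurable_continuous_onI[OF continuous_on_grad_conjugate]])

lemma measurable_x_Suc:
  assumes G: "space G = space M" and k: "Suc k \<le> K"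
    and "z k \<in> borel_measurable G" "Y k \<in> borel_measurable G"
  shows "x (Suc k) \<in> borel_measurable G"
    and "(\<lambda>\<omega>. gf (x (Suc k) \<omega>)) \<in> borel_measurable G"
proof -
  have "(\<lambda>\<omega>. ((\<Sum>i=1..k. a i) / ((\<Sum>i=1..k. a i) + a (Suc k))) *\<^sub>R Y k \<omega>
      + (a (Suc k) / ((\<Sum>i=1..k. a i) + a (Suc k))) *\<^sub>R mirror (z k \<omega>)) \<in> borel_measurable G"
    using assms(3,4) by (intro borel_measurable_add borel_measurable_scaleR measurable_mirror) auto
  \<comment> \<open>The recursion is known only for outcomes in \<open>space M\<close>;
    measurability transfers along equality there.\<close>
  then show x: "x (Suc k) \<in> borel_measurable G"
    by (rule measurable_cong[THEN iffD2, rotated]) (use agd_run.x_Suc[OF agd_run k] G in auto)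
  show "(\<lambda>\<omega>. gf (x (Suc k) \<omega>)) \<in> borel_measurable G"
    using continuous_gf x
    by (rule measurable_continuous_on_X) (use agd_run.x_in[OF agd_run k] G in auto)
qed

text \<open>\<open>G\<close> is kept general so as to be both \<open>M\<close> and the sigma-algebra
  generated by the first \<open>k\<close> errors; the latter choice expresses that the iterates
  depend on nothing else.\<close>

lemma measurable_iterates:
  assumes G: "space G = space M"
  shows "k \<le> K \<Longrightarrow> (\<And>i. i \<in> {1..k} \<Longrightarrow> \<eta> i \<in> borel_measurable G) \<Longrightarrow>
    z k \<in> borel_measurable G \<and> Y k \<in> borel_measurable G"
proof (induction k)
  case 0
  have "(\<lambda>\<omega>. g\<psi> x0) \<in> borel_measurable G" by simp
  then have "z 0 \<in> borel_measurable G"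
    by (rule measurable_cong[THEN iffD2, rotated]) (use agd_run.z_0[OF agd_run] G in auto)
  then show ?case by (simp add: init_def)
next
  case (Suc k)
  then have IH: "z k \<in> borel_measurable G" "Y k \<in> borel_measurable G" and k: "Suc k \<le> K"
    by auto
  have "(\<lambda>\<omega>. z k \<omega> - a (Suc k) *\<^sub>R (gf (x (Suc k) \<omega>) + \<eta> (Suc k) \<omega>)) \<in> borel_measurable G"
    using IH(1) measurable_x_Suc(2)[OF G k IH] Suc.prems
    by (intro borel_measurable_diff borel_measurable_scaleR borel_measurable_add) auto
  then have z: "z (Suc k) \<in> borel_measurable G"
    by (rule measurable_cong[THEN iffD2, rotated]) (use agd_run.z_Suc[OF agd_run k] G in auto)
  have "(\<lambda>\<omega>. ((\<Sum>i=1..k. a i) / ((\<Sum>i=1..k. a i) + a (Suc k))) *\<^sub>R Y k \<omega>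
      + (a (Suc k) / ((\<Sum>i=1..k. a i) + a (Suc k))) *\<^sub>R mirror (z (Suc k) \<omega>))
      \<in> borel_measurable G"
    using IH(2) z by (intro borel_measurable_add borel_measurable_scaleR measurable_mirror) auto
  then have "Y (Suc k) \<in> borel_measurable G"
    by (rule measurable_cong[THEN iffD2, rotated]) (use agd_run.y_Suc[OF agd_run k] G in auto)
  then show ?case using z by simp
qed

lemma
  assumes "k \<le> K"
  shows measurable_z: "z k \<in> borel_measurable M"
    and measurable_Y: "Y k \<in> borel_measurable M"
proof -
  have "\<eta> i \<in> borel_measurable M" if "i \<in> {1..k}" for i
    using measurable_\<eta>[of i] that assms by simp
  from measurable_iterates[OF refl assms this]
  show "z k \<in> borel_measurable M" "Y k \<in> borel_measurable M" by blast+
qed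

text \<open>The mirror point of the step \<open>Suc k\<close> with an exact gradient. It depends only on the
  errors of the earlier steps.\<close>

definition noiseless :: "nat \<Rightarrow> 'w \<Rightarrow> 'a" where
  "noiseless k \<omega> = mirror (z k \<omega> - a (Suc k) *\<^sub>R gf (x (Suc k) \<omega>))"

lemma measurable_noiseless:
  assumes "space G = space M" "Suc k \<le> K" "\<And>i. i \<in> {1..k} \<Longrightarrow> \<eta> i \<in> borel_measurable G"
  shows "noiseless k \<in> borel_measurable G"
proof -
  have "z k \<in> borel_measurable G" "Y k \<in> borel_measurable G"
    using measurable_iterates[of G k] assms by auto
  moreover from this have "(\<lambda>\<omega>. gf (x (Suc k) \<omega>)) \<in> borel_measurable G"
    using measurable_x_Suc[of G k] assms(1,2) by blast
  ultimately show ?thesis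
    unfolding noiseless_def
    by (intro measurable_mirror borel_measurable_diff borel_measurable_scaleR) auto
qed

text \<open>The error \<open>Suc k\<close> and the block of errors \<open>1..k\<close> are
  independent, and \<open>noiseless k\<close> is measurable for the sigma-algebra of that block. For
  \<open>k = 0\<close> the block is empty.\<close>

lemma indep_noiseless:
  assumes k: "Suc k \<le> K"
  shows "indep_var borel (\<eta> (Suc k)) borel (\<lambda>\<omega>. xs - noiseless k \<omega>)"
proof -
  let ?V = "\<lambda>I \<omega>. \<lambda>i\<in>I. \<eta> i \<omega>"
    and ?T = "\<lambda>I. Pi\<^sub>M I (\<lambda>_. borel) :: (nat \<Rightarrow> 'a) measure"
  let ?G = "\<lambda>I. vimage_algebra (space M) (?V I) (?T I)"
  have past: "\<eta> i \<in> borel_measurable (?G I)" if i: "i \<in> I" for i I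
  proof -
    have V: "?V I \<in> ?G I \<rightarrow>\<^sub>M ?T I"
      by (rule measurable_vimage_algebra1) (auto simp: space_PiM)
    have "(\<lambda>\<omega>. ?V I \<omega> i) \<in> borel_measurable (?G I)"
      by (rule measurable_compose[OF V measurable_component_singleton[OF i]])
    then show ?thesis using i by simp
  qed
  have "(\<lambda>\<omega>. xs - noiseless k \<omega>) \<in> borel_measurable (?G {1..k})"
    using k past by (intro borel_measurable_diff measurable_noiseless) auto
  moreover have "\<eta> (Suc k) \<in> borel_measurable (?G {Suc k})" by (rule past) simp
  moreover have "indep_var (?T {Suc k}) (?V {Suc k}) (?T {1..k}) (?V {1..k})"
    using k by (intro indep_var_restrict[OF indep]) auto
  ultimately show ?thesis using indep_var_vimage_algebra by blast
qed

text \<open>The two arguments of \<open>mirror\<close> differ exactly by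
  \<open>a (Suc k) *\<^sub>R \<eta> (Suc k) \<omega>\<close>, to which the Lipschitz bound
  applies.\<close>

lemma mirror_diff_noiseless:
  assumes k: "Suc k \<le> K" and \<omega>: "\<omega> \<in> space M"
  shows "N (noiseless k \<omega> - mirror (z (Suc k) \<omega>)) \<le> a (Suc k) * dual_norm N (\<eta> (Suc k) \<omega>) / \<mu>"
proof -
  have "N (noiseless k \<omega> - mirror (z (Suc k) \<omega>))
      \<le> dual_norm N (a (Suc k) *\<^sub>R \<eta> (Suc k) \<omega>) / \<mu>"
    using grad_conjugate_lipschitz[of "z k \<omega> - a (Suc k) *\<^sub>R gf (x (Suc k) \<omega>)" "z (Suc k) \<omega>"]
    by (simp add: noiseless_def agd_run.z_Suc[OF agd_run[OF \<omega>] k] algebra_simps)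
  also have "\<dots> \<le> a (Suc k) * dual_norm N (\<eta> (Suc k) \<omega>) / \<mu>"
    using a_pos[of "Suc k"] k \<mu>_pos by (intro divide_right_mono dual_scale_le) auto
  finally show ?thesis .
qed

section \<open>Second moments and integrability\<close>

lemma potential_integrable_bound:
  "k \<le> K \<Longrightarrow> \<exists>Q. integrable M Q \<and> (\<forall>\<omega>\<in>space M. P k \<omega> \<le> Q \<omega>)"
proof (induction k)
  case 0
  then show ?case
    using agd_run.potential_0[OF agd_run]
    by (intro exI[of _ "\<lambda>_. bregman \<psi> g\<psi> xs x0"]) auto
next
  case (Suc k)
  then obtain Q where Q: "integrable M Q" "\<And>\<omega>. \<omega> \<in> space M \<Longrightarrow> P k \<omega> \<le> Q \<omega>" by auto
  \<comment> \<open>An integrable majorant is carried along; the doubling at each step is harmless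
    because only finiteness matters over at most \<open>K\<close> steps.\<close>
  let ?Q = "\<lambda>\<omega>. 2 * Q \<omega> + 2 * (a (Suc k))\<^sup>2 * (dual_norm N (\<eta> (Suc k) \<omega>))\<^sup>2 / \<mu>"
  have "integrable M ?Q"
    using Q(1) integrable_dual[of "Suc k"] Suc.prems by auto
  moreover have "P (Suc k) \<omega> \<le> ?Q \<omega>" if "\<omega> \<in> space M" for \<omega>
    using agd_run.potential_Suc_le_double[OF agd_run[OF that] Suc.prems step] Q(2)[OF that]
      Suc.prems by simp
  ultimately show ?case by blast
qed

lemma integrable_sq_dist:
  assumes k: "k \<le> K"
  shows "integrable M (\<lambda>\<omega>. (N (xs - mirror (z k \<omega>)))\<^sup>2)"
proof -
  obtain Q where Q: "integrable M Q" "\<And>\<omega>. \<omega> \<in> space M \<Longrightarrow> P k \<omega> \<le> Q \<omega>"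
    using potential_integrable_bound[OF k] by blast
  show ?thesis
  proof (rule Bochner_Integration.integrable_bound)
    show "integrable M (\<lambda>\<omega>. 2 / \<mu> * Q \<omega>)" using Q(1) by auto
    have "(\<lambda>\<omega>. xs - mirror (z k \<omega>)) \<in> borel_measurable M"
      using measurable_mirror[OF measurable_z[OF k]] by auto
    then have "(\<lambda>\<omega>. N (xs - mirror (z k \<omega>))) \<in> borel_measurable M"
      by (rule measurable_compose[OF _ borel_measurable_continuous_onI[OF continuous_on]])
    then show "(\<lambda>\<omega>. (N (xs - mirror (z k \<omega>)))\<^sup>2) \<in> borel_measurable M" by auto
    show "AE \<omega> in M. norm ((N (xs - mirror (z k \<omega>)))\<^sup>2) \<le> norm (2 / \<mu> * Q \<omega>)"
    proof (rule AE_I2)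
      fix \<omega> assume \<omega>: "\<omega> \<in> space M"
      have "\<mu> / 2 * (N (xs - mirror (z k \<omega>)))\<^sup>2 \<le> Q \<omega>"
        using agd_run.potential_ge(2)[OF agd_run[OF \<omega>] k] Q(2)[OF \<omega>] by linarith
      then have "(N (xs - mirror (z k \<omega>)))\<^sup>2 \<le> 2 / \<mu> * Q \<omega>"
        using \<mu>_pos by (simp add: field_simps)
      then show "norm ((N (xs - mirror (z k \<omega>)))\<^sup>2) \<le> norm (2 / \<mu> * Q \<omega>)"
        using abs_ge_self[of "2 / \<mu> * Q \<omega>"] unfolding real_norm_def by simp
    qed
  qed
qed

lemma integrable_noise_inner:
  assumes k: "k \<in> {1..K}"
  shows "integrable M (\<lambda>\<omega>. \<eta> k \<omega> \<bullet> (xs - mirror (z k \<omega>)))"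
proof (rule Bochner_Integration.integrable_bound)
  show "integrable M (\<lambda>\<omega>. (dual_norm N (\<eta> k \<omega>))\<^sup>2 + (N (xs - mirror (z k \<omega>)))\<^sup>2)"
    using k integrable_dual integrable_sq_dist by auto
  show "(\<lambda>\<omega>. \<eta> k \<omega> \<bullet> (xs - mirror (z k \<omega>))) \<in> borel_measurable M"
    using k measurable_\<eta>[OF k] measurable_mirror[OF measurable_z]
    by (intro borel_measurable_inner borel_measurable_diff) auto
  show "AE \<omega> in M. norm (\<eta> k \<omega> \<bullet> (xs - mirror (z k \<omega>)))
      \<le> norm ((dual_norm N (\<eta> k \<omega>))\<^sup>2 + (N (xs - mirror (z k \<omega>)))\<^sup>2)"
  proof (rule AE_I2)
    fix \<omega>
    let ?d = "dual_norm N (\<eta> k \<omega>)" and ?n = "N (xs - mirror (z k \<omega>))"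
    have "\<bar>\<eta> k \<omega> \<bullet> (xs - mirror (z k \<omega>))\<bar> \<le> ?d * ?n" by (rule abs_inner_le_dual)
    also have "\<dots> \<le> ?d\<^sup>2 + ?n\<^sup>2"
      using sum_squares_bound[of ?d ?n] dual_nonneg[of "\<eta> k \<omega>"] nonneg[of "xs - mirror (z k \<omega>)"]
        mult_nonneg_nonneg[of ?d ?n] by linarith
    finally show "norm (\<eta> k \<omega> \<bullet> (xs - mirror (z k \<omega>))) \<le> norm (?d\<^sup>2 + ?n\<^sup>2)" by simp
  qed
qed

text \<open>The difference is split at the actual mirror point, whose distance to \<open>xs\<close>
  has a second moment; the rest is bounded by \<open>mirror_diff_noiseless\<close>.\<close>

lemma integrable_noiseless:
  assumes k: "Suc k \<le> K"
  shows "integrable M (\<lambda>\<omega>. xs - noiseless k \<omega>)"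
proof -
  obtain c where c: "c > 0" "\<And>v. c * norm v \<le> N v" using ge_norm by blast
  let ?d = "\<lambda>\<omega>. dual_norm N (\<eta> (Suc k) \<omega>)" and ?n = "\<lambda>\<omega>. N (xs - mirror (z (Suc k) \<omega>))"
  let ?b = "\<lambda>\<omega>. (1 / c) * ((1 + (?n \<omega>)\<^sup>2) + a (Suc k) / \<mu> * (1 + (?d \<omega>)\<^sup>2))"
  \<comment> \<open>Turns first powers into squares, whose integrability is known.\<close>
  have r: "r \<le> 1 + r\<^sup>2" for r :: real
    using sum_squares_bound[of r 1] zero_le_power2[of r] by (simp, linarith)
  show ?thesis
  proof (rule Bochner_Integration.integrable_bound)
    show "integrable M ?b"
      using k integrable_dual[of "Suc k"] integrable_sq_dist[of "Suc k"] by auto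
    show "(\<lambda>\<omega>. xs - noiseless k \<omega>) \<in> borel_measurable M"
      using measurable_noiseless[of M k] measurable_\<eta> k by (intro borel_measurable_diff) auto
    show "AE \<omega> in M. norm (xs - noiseless k \<omega>) \<le> norm (?b \<omega>)"
    proof (rule AE_I2)
      fix \<omega> assume \<omega>: "\<omega> \<in> space M"
      have "c * norm (xs - noiseless k \<omega>) \<le> N (xs - noiseless k \<omega>)" by (rule c(2))
      also have "\<dots> \<le> ?n \<omega> + N (noiseless k \<omega> - mirror (z (Suc k) \<omega>))"
        using triangle[of "xs - mirror (z (Suc k) \<omega>)" "mirror (z (Suc k) \<omega>) - noiseless k \<omega>"]
          diff_commute[of "noiseless k \<omega>"] by simp
      also have "\<dots> \<le> ?n \<omega> + a (Suc k) / \<mu> * ?d \<omega>"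
        using mirror_diff_noiseless[OF k \<omega>] by simp
      also have "\<dots> \<le> (1 + (?n \<omega>)\<^sup>2) + a (Suc k) / \<mu> * (1 + (?d \<omega>)\<^sup>2)"
        using a_pos[of "Suc k"] k \<mu>_pos by (intro add_mono mult_left_mono r) auto
      finally have "norm (xs - noiseless k \<omega>) \<le> ?b \<omega>" using c(1) by (simp add: field_simps)
      also have "\<dots> \<le> norm (?b \<omega>)" unfolding real_norm_def by (rule abs_ge_self)
      finally show "norm (xs - noiseless k \<omega>) \<le> norm (?b \<omega>)" .
    qed
  qed
qed

section \<open>Expectation of the noise terms and of the final error\<close>

lemma expectation_noise_inner:
  assumes k: "k \<in> {1..K}"
  shows "(\<integral>\<omega>. \<eta> k \<omega> \<bullet> (xs - mirror (z k \<omega>)) \<partial>M) \<le> a k / \<mu> * (\<integral>\<omega>. (dual_norm N (\<eta> k \<omega>))\<^sup>2 \<partial>M)"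
proof -
  obtain j where j: "k = Suc j" "Suc j \<le> K" using k by (cases k) auto
  \<comment> \<open>By independence the expectation factorises, and the factor of
    \<open>\<eta> k\<close> is zero.\<close>
  have "integrable M (\<lambda>\<omega>. \<eta> k \<omega> \<bullet> (xs - noiseless j \<omega>))"
    and zero: "(\<integral>\<omega>. \<eta> k \<omega> \<bullet> (xs - noiseless j \<omega>) \<partial>M) = 0"
    using indep_var_inner_integral[OF indep_noiseless[OF j(2)] integrable_\<eta>
        integrable_noiseless[OF j(2)]] mean_\<eta>[OF k] k j by auto
  then have int: "integrable M (\<lambda>\<omega>. \<eta> k \<omega> \<bullet> (xs - noiseless j \<omega>)
      + a k / \<mu> * (dual_norm N (\<eta> k \<omega>))\<^sup>2)"
    using integrable_dual[OF k] by auto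
  have "(\<integral>\<omega>. \<eta> k \<omega> \<bullet> (xs - mirror (z k \<omega>)) \<partial>M)
      \<le> (\<integral>\<omega>. \<eta> k \<omega> \<bullet> (xs - noiseless j \<omega>) + a k / \<mu> * (dual_norm N (\<eta> k \<omega>))\<^sup>2 \<partial>M)"
  proof (rule integral_mono[OF integrable_noise_inner[OF k] int])
    fix \<omega> assume \<omega>: "\<omega> \<in> space M"
    have "\<eta> k \<omega> \<bullet> (noiseless j \<omega> - mirror (z k \<omega>))
        \<le> dual_norm N (\<eta> k \<omega>) * N (noiseless j \<omega> - mirror (z k \<omega>))"
      by (rule inner_le_dual)
    also have "\<dots> \<le> dual_norm N (\<eta> k \<omega>) * (a k * dual_norm N (\<eta> k \<omega>) / \<mu>)"
      using mirror_diff_noiseless[OF j(2) \<omega>] dual_nonneg j(1) by (intro mult_left_mono) auto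
    finally show "\<eta> k \<omega> \<bullet> (xs - mirror (z k \<omega>))
        \<le> \<eta> k \<omega> \<bullet> (xs - noiseless j \<omega>) + a k / \<mu> * (dual_norm N (\<eta> k \<omega>))\<^sup>2"
      by (simp add: inner_diff_right power2_eq_square mult_ac)
  qed
  also have "\<dots> = a k / \<mu> * (\<integral>\<omega>. (dual_norm N (\<eta> k \<omega>))\<^sup>2 \<partial>M)"
    using zero integrable_dual[OF k] \<open>integrable M (\<lambda>\<omega>. \<eta> k \<omega> \<bullet> (xs - noiseless j \<omega>))\<close> by simp
  finally show ?thesis .
qed

lemma potential_le_sum:
  assumes \<omega>: "\<omega> \<in> space M"
  shows "k \<le> K \<Longrightarrow> P k \<omega>
    \<le> bregman \<psi> g\<psi> xs x0 + (\<Sum>i=1..k. a i * (\<eta> i \<omega> \<bullet> (xs - mirror (z i \<omega>))))"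
proof (induction k)
  case 0
  then show ?case using agd_run.potential_0[OF agd_run[OF \<omega>]] by simp
next
  case (Suc k)
  then show ?case
    using agd_run.potential_Suc[OF agd_run[OF \<omega>] Suc.prems] step[of "Suc k"] by simp
qed

lemma expected_error:
  "expectation_le M (\<lambda>\<omega>. f (y K \<omega>) - f xs)
    (bregman \<psi> g\<psi> xs x0 / (\<Sum>i=1..K. a i)
      + (\<Sum>i=1..K. (a i)\<^sup>2 * (\<integral>\<omega>. (dual_norm N (\<eta> i \<omega>))\<^sup>2 \<partial>M)) / (\<mu> * (\<Sum>i=1..K. a i)))"
proof -
  define S where "S = (\<Sum>i=1..K. a i)"
  let ?D = "bregman \<psi> g\<psi> xs x0" and ?V = "\<lambda>i. \<integral>\<omega>. (dual_norm N (\<eta> i \<omega>))\<^sup>2 \<partial>M"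
  let ?B = "\<lambda>\<omega>. (?D + (\<Sum>i=1..K. a i * (\<eta> i \<omega> \<bullet> (xs - mirror (z i \<omega>))))) / S"
  have S: "S > 0" unfolding S_def using K_pos a_pos by (intro sum_pos) auto
  \<comment> \<open>\<open>init\<close> replaces only index 0, so at \<open>K\<close> it returns the
    true iterate.\<close>
  have Y: "Y K \<omega> = y K \<omega>" for \<omega> using K_pos by (simp add: init_def)
  have y_in: "y K \<omega> \<in> X" if "\<omega> \<in> space M" for \<omega>
    using agd_run.init_y_in[OF agd_run[OF that], of K] by (simp add: Y)
  have int_sum: "integrable M (\<lambda>\<omega>. \<Sum>i=1..K. a i * (\<eta> i \<omega> \<bullet> (xs - mirror (z i \<omega>))))"
    using integrable_noise_inner by (intro Bochner_Integration.integrable_sum) auto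
  then have int_B: "integrable M ?B" by (intro integrable_divide integrable_add) auto
  have le_B: "f (y K \<omega>) - f xs \<le> ?B \<omega>" if "\<omega> \<in> space M" for \<omega>
  proof -
    have "S * (f (y K \<omega>) - f xs) \<le> P K \<omega>"
      using agd_run.potential_ge(1)[OF agd_run[OF that] order_refl] unfolding Y S_def .
    also have "\<dots> \<le> ?D + (\<Sum>i=1..K. a i * (\<eta> i \<omega> \<bullet> (xs - mirror (z i \<omega>))))"
      by (rule potential_le_sum[OF that order_refl])
    finally have "(f (y K \<omega>) - f xs) * S
        \<le> ?D + (\<Sum>i=1..K. a i * (\<eta> i \<omega> \<bullet> (xs - mirror (z i \<omega>))))"
      by (simp only: mult.commute)
    then show ?thesis using S by (simp only: pos_le_divide_eq)
  qed
  \<comment> \<open>The error is nonnegative, so its upper bound \<open>?B\<close> dominates it in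
    absolute value.\<close>
  have int: "integrable M (\<lambda>\<omega>. f (y K \<omega>) - f xs)"
  proof (rule Bochner_Integration.integrable_bound[OF int_B])
    have "(\<lambda>\<omega>. f (y K \<omega>)) \<in> borel_measurable M"
      using has_gradient_on_imp_continuous_on[OF gradient_f]
        measurable_Y[OF order_refl, unfolded Y] y_in
      by (rule measurable_continuous_on_X)
    then show "(\<lambda>\<omega>. f (y K \<omega>) - f xs) \<in> borel_measurable M" by auto
    show "AE \<omega> in M. norm (f (y K \<omega>) - f xs) \<le> norm (?B \<omega>)"
    proof (rule AE_I2)
      fix \<omega> assume "\<omega> \<in> space M"
      then show "norm (f (y K \<omega>) - f xs) \<le> norm (?B \<omega>)"
        using le_B[of \<omega>] f_ge[OF y_in[of \<omega>]] unfolding real_norm_def by linarith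
    qed
  qed
  have "(\<integral>\<omega>. f (y K \<omega>) - f xs \<partial>M) \<le> (\<integral>\<omega>. ?B \<omega> \<partial>M)"
    using int int_B le_B by (rule integral_mono)
  also have "\<dots> = (?D + (\<Sum>i=1..K. a i * (\<integral>\<omega>. \<eta> i \<omega> \<bullet> (xs - mirror (z i \<omega>)) \<partial>M))) / S"
  proof -
    have "(\<integral>\<omega>. (\<Sum>i=1..K. a i * (\<eta> i \<omega> \<bullet> (xs - mirror (z i \<omega>)))) \<partial>M)
        = (\<Sum>i=1..K. (\<integral>\<omega>. a i * (\<eta> i \<omega> \<bullet> (xs - mirror (z i \<omega>))) \<partial>M))"
      using integrable_noise_inner by (intro Bochner_Integration.integral_sum) auto
    with int_sum have "(\<integral>\<omega>. ?D + (\<Sum>i=1..K. a i * (\<eta> i \<omega> \<bullet> (xs - mirror (z i \<omega>)))) \<partial>M)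
        = ?D + (\<Sum>i=1..K. (\<integral>\<omega>. a i * (\<eta> i \<omega> \<bullet> (xs - mirror (z i \<omega>))) \<partial>M))"
      by (subst Bochner_Integration.integral_add) (simp_all add: prob_space)
    then show ?thesis by simp
  qed
  also have "\<dots> \<le> (?D + (\<Sum>i=1..K. a i * (a i / \<mu> * ?V i))) / S"
    using S a_pos expectation_noise_inner
    by (intro divide_right_mono add_left_mono sum_mono mult_left_mono) (auto intro: less_imp_le)
  also have "\<dots> = ?D / S + (\<Sum>i=1..K. (a i)\<^sup>2 * ?V i) / (\<mu> * S)"
    by (simp add: add_divide_distrib sum_divide_distrib power2_eq_square mult_ac)
  finally show ?thesis
    using int unfolding expectation_le_def S_def by blast
qed

end

subsection \<open>Step sizes\<close>

lemma expectation_le_mono: "expectation_le M Y c \<Longrightarrow> c \<le> d \<Longrightarrow> expectation_le M Y d"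
  by (auto simp: expectation_le_def)

lemma sum_power2_scale:
  fixes c :: "'a::comm_semiring_1"
  shows "(\<Sum>i\<in>I. (c * b i)\<^sup>2 * v i) = c\<^sup>2 * (\<Sum>i\<in>I. (b i)\<^sup>2 * v i)"
  by (simp add: sum_distrib_left power_mult_distrib mult_ac)

lemma sum_linear_weights: "(\<Sum>i=1..k. (real i + 1) / 2) = real k * (real k + 3) / 4"
  by (induction k) (simp_all add: field_simps)

text \<open>Bounding every summand by the square of \<open>(K + 3) / 2\<close> is generous but makes
  the factor \<open>K + 3\<close> cancel; the resulting 2 is the value of
  \<open>absolute_const\<close>.\<close>

lemma sqrt_sum_linear_weights_le:
  assumes "K \<ge> 1"
  shows "sqrt (\<Sum>i=1..K. ((real i + 1) / 2)\<^sup>2) / (real K * (real K + 3) / 4) \<le> 2 / sqrt (real K)"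
proof -
  have "(\<Sum>i=1..K. ((real i + 1) / 2)\<^sup>2) \<le> (\<Sum>i=1..K. ((real K + 3) / 2)\<^sup>2)"
    by (intro sum_mono power_mono) auto
  then have "(\<Sum>i=1..K. ((real i + 1) / 2)\<^sup>2) \<le> real K * ((real K + 3) / 2)\<^sup>2"
    by simp
  then have "sqrt (\<Sum>i=1..K. ((real i + 1) / 2)\<^sup>2) \<le> sqrt (real K * ((real K + 3) / 2)\<^sup>2)"
    by (rule real_sqrt_le_mono)
  also have "\<dots> = sqrt (real K) * ((real K + 3) / 2)"
    by (simp add: real_sqrt_mult)
  finally have "sqrt (\<Sum>i=1..K. ((real i + 1) / 2)\<^sup>2) / (real K * (real K + 3) / 4)
      \<le> sqrt (real K) * ((real K + 3) / 2) / (real K * (real K + 3) / 4)"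
    by (rule divide_right_mono) simp
  also have "\<dots> = 2 * (sqrt (real K) / real K)"
    by (simp add: divide_simps)
  also have "\<dots> = 2 / sqrt (real K)"
    by (simp add: divide_simps)
  finally show ?thesis .
qed

text \<open>After cancelling powers of \<open>\<gamma>\<close> the claim is
  \<open>(i + 1)\<^sup>2 \<le> i * (i + 3)\<close>, which amounts to
  \<open>1 \<le> i\<close>.\<close>

lemma linear_weights_step:
  assumes "\<gamma> > (0::real)" and "i \<ge> 1"
  shows "(\<gamma> * ((real i + 1) / 2))\<^sup>2 / (\<Sum>j=1..i. \<gamma> * ((real j + 1) / 2)) \<le> \<gamma>"
proof -
  have "(real i + 1)\<^sup>2 \<le> real i * (real i + 3)"
    using assms(2) by (simp add: power2_eq_square algebra_simps)
  then have "\<gamma> * \<gamma> * (real i + 1)\<^sup>2 \<le> \<gamma> * \<gamma> * (real i * (real i + 3))"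
    by (intro mult_left_mono) auto
  moreover have "(\<Sum>j=1..i. \<gamma> * ((real j + 1) / 2)) = \<gamma> * (real i * (real i + 3) / 4)"
    by (simp only: sum_distrib_left[symmetric] sum_linear_weights)
  ultimately show ?thesis
    using assms by (simp add: divide_le_eq power_mult_distrib power_divide power2_eq_square mult_ac)
qed

section \<open>The three rates\<close>

theorem corollary3p9:
  fixes X :: "(real ^ 'n) set"
    and N :: "real ^ 'n \<Rightarrow> real"
    and f \<psi> :: "real ^ 'n \<Rightarrow> real"
    and gf g\<psi> :: "real ^ 'n \<Rightarrow> real ^ 'n"
    and x0 xs :: "real ^ 'n"
    and L \<mu> :: real
    and M :: "'w measure"
    and \<eta> :: "nat \<Rightarrow> 'w \<Rightarrow> real ^ 'n"
    and K :: nat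
  assumes "is_norm N"
    and "closed X" and "convex X"
    and "convex_on X f" and "has_gradient_on f gf X" and "continuous_on X gf"
    and "L > 0" and "L_smooth_on N L f gf X"
    and "is_arg_min f (\<lambda>x. x \<in> X) xs"
    and "x0 \<in> X"
    and "has_gradient_on \<psi> g\<psi> X"
    and "\<mu> > 0" and "strongly_convex_on N \<mu> \<psi> g\<psi> X"
    and "prob_space M"
    and "prob_space.indep_vars M (\<lambda>_. borel) \<eta> {1..K}"
    and "\<And>i. i \<in> {1..K} \<Longrightarrow> integrable M (\<eta> i)"
    and "\<And>i. i \<in> {1..K} \<Longrightarrow> (\<integral>\<omega>. \<eta> i \<omega> \<partial>M) = 0"
    and "\<And>i. i \<in> {1..K} \<Longrightarrow> integrable M (\<lambda>\<omega>. (dual_norm N (\<eta> i \<omega>))\<^sup>2)"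
    and "K \<ge> 1"
  shows
    "let V = (\<lambda>i. \<integral>\<omega>. (dual_norm N (\<eta> i \<omega>))\<^sup>2 \<partial>M);
         D = bregman \<psi> g\<psi> xs x0
     in
      (\<forall>b x y z.
        let \<gamma> = \<mu> / max L (sqrt (\<Sum>i=1..K. (b i)\<^sup>2 * V i));
            a = (\<lambda>i. \<gamma> * b i);
            A = (\<lambda>k. \<Sum>i=1..k. a i)
        in
          (\<forall>i\<in>{1..K}. b i > 0) \<longrightarrow>
          (\<forall>i\<in>{1..K}. (a i)\<^sup>2 / A i \<le> \<gamma>) \<longrightarrow>
          (\<forall>\<omega>\<in>space M. AGD_plus X gf \<psi> g\<psi> x0 a (\<lambda>k. \<eta> k \<omega>)
             (\<lambda>k. x k \<omega>) (\<lambda>k. y k \<omega>) (\<lambda>k. z k \<omega>)) \<longrightarrow>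
          expectation_le M (\<lambda>\<omega>. f (y K \<omega>) - f xs)
            (D / A K + sqrt (\<Sum>i=1..K. (a i)\<^sup>2 * V i) / A K)) \<and>
      (\<forall>\<sigma> x y z.
        let b = (\<lambda>i. (real i + 1) / 2);
            \<gamma> = \<mu> / max L (sqrt (\<Sum>i=1..K. (b i)\<^sup>2 * V i));
            a = (\<lambda>i. \<gamma> * b i)
        in
          \<sigma> \<ge> 0 \<longrightarrow>
          (\<forall>i\<in>{1..K}. V i \<le> \<sigma>\<^sup>2) \<longrightarrow>
          (\<forall>\<omega>\<in>space M. AGD_plus X gf \<psi> g\<psi> x0 a (\<lambda>k. \<eta> k \<omega>)
             (\<lambda>k. x k \<omega>) (\<lambda>k. y k \<omega>) (\<lambda>k. z k \<omega>)) \<longrightarrow>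
          expectation_le M (\<lambda>\<omega>. f (y K \<omega>) - f xs)
            (4 * L * D / (\<mu> * real K * (real K + 3)) +
             absolute_const * (\<sigma> * (\<mu> + D) / (\<mu> * sqrt (real K))))) \<and>
      (\<forall>\<sigma> x y z.
        let b = (\<lambda>i. (real i + 1) / 2);
            \<gamma> = \<mu> / max L (sqrt (\<Sum>i=1..K. (b i)\<^sup>2));
            a = (\<lambda>i. \<gamma> * b i)
        in
          \<sigma> \<ge> 0 \<longrightarrow>
          (\<forall>i\<in>{1..K}. V i \<le> \<sigma>\<^sup>2) \<longrightarrow>
          (\<forall>\<omega>\<in>space M. AGD_plus X gf \<psi> g\<psi> x0 a (\<lambda>k. \<eta> k \<omega>)
             (\<lambda>k. x k \<omega>) (\<lambda>k. y k \<omega>) (\<lambda>k. z k \<omega>)) \<longrightarrow>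
          expectation_le M (\<lambda>\<omega>. f (y K \<omega>) - f xs)
            (absolute_const * (\<sigma>\<^sup>2 / sqrt (real K)) +
             max (4 * L * D / (\<mu> * real K * (real K + 3)))
                 (absolute_const * (D / (\<mu> * sqrt (real K))))))"
proof -
  let ?V = "\<lambda>i. \<integral>\<omega>. (dual_norm N (\<eta> i \<omega>))\<^sup>2 \<partial>M"
  let ?D = "bregman \<psi> g\<psi> xs x0"
  have mirror: "mirror_map N X \<psi> g\<psi> \<mu>"
    using assms(1,2,3,10,11,12,13)
    by (intro mirror_map.intro norm_fun.intro mirror_map_axioms.intro) auto
  have problem: "agd_problem N X \<psi> g\<psi> \<mu> f gf L x0 xs"
    using assms(4,5,6,8,9,10) mirror
    by (intro agd_problem.intro agd_problem_axioms.intro)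
  have D: "0 \<le> ?D"
    using mirror_map.bregman_nonneg[OF mirror assms(10) agd_problem.xs_in[OF problem]] .
  have V: "0 \<le> ?V i" for i by (rule Bochner_Integration.integral_nonneg) simp
  \<comment> \<open>Common source of all three parts: \<open>\<gamma> * L \<le> \<mu>\<close> and
    the ratio condition on the weights together give the step-size condition of the
    analysis.\<close>
  have core: "expectation_le M (\<lambda>\<omega>. f (y K \<omega>) - f xs)
      (?D / (\<Sum>i=1..K. \<gamma> * b i)
        + (\<Sum>i=1..K. (\<gamma> * b i)\<^sup>2 * ?V i) / (\<mu> * (\<Sum>i=1..K. \<gamma> * b i)))"
    if \<gamma>: "0 < \<gamma>" "\<gamma> * L \<le> \<mu>" and b: "\<forall>i\<in>{1..K}. b i > 0"
      and step: "\<forall>i\<in>{1..K}. (\<gamma> * b i)\<^sup>2 / (\<Sum>j=1..i. \<gamma> * b j) \<le> \<gamma>"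
      and run: "\<forall>\<omega>\<in>space M. AGD_plus X gf \<psi> g\<psi> x0 (\<lambda>i. \<gamma> * b i) (\<lambda>k. \<eta> k \<omega>)
        (\<lambda>k. x k \<omega>) (\<lambda>k. y k \<omega>) (\<lambda>k. z k \<omega>)"
    for \<gamma> b x y z
  proof -
    have pos: "0 < \<gamma> * b i" if "i \<in> {1..K}" for i using that \<gamma> b by simp
    have "L * (\<gamma> * b i)\<^sup>2 \<le> \<mu> * (\<Sum>j=1..i. \<gamma> * b j)" if i: "i \<in> {1..K}" for i
    proof -
      let ?A = "\<Sum>j=1..i. \<gamma> * b j"
      have A: "0 < ?A" using i by (intro sum_pos pos) auto
      have "(\<gamma> * b i)\<^sup>2 \<le> \<gamma> * ?A"
        using bspec[OF step i] by (rule pos_divide_le_eq[OF A, THEN iffD1])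
      then have "L * (\<gamma> * b i)\<^sup>2 \<le> L * (\<gamma> * ?A)"
        using \<open>L > 0\<close> by (intro mult_left_mono) auto
      also have "\<dots> = (\<gamma> * L) * ?A" by (simp only: mult_ac)
      also have "\<dots> \<le> \<mu> * ?A" using \<gamma>(2) A by (intro mult_right_mono) auto
      finally show ?thesis .
    qed
    then have "agd_stochastic N X \<psi> g\<psi> \<mu> f gf L x0 xs M (\<lambda>i. \<gamma> * b i) \<eta> x y z K"
      using run pos assms(14-19)
      by (intro agd_stochastic.intro agd_stochastic_axioms.intro problem) blast+
    then show ?thesis by (rule agd_stochastic.expected_error)
  qed
  \<comment> \<open>The maximum in the denominator serves two purposes: the bound with
    \<open>L\<close> controls the smoothness error, the bound with \<open>S\<close> the
    noise.\<close>
  have rate: "0 < \<mu> / max L S" "\<mu> / max L S * L \<le> \<mu>" "\<mu> / max L S * S \<le> \<mu>" for S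
    using \<open>L > 0\<close> \<open>\<mu> > 0\<close> by (simp_all add: divide_le_eq mult_left_mono less_max_iff_disj)
  have part1: "expectation_le M (\<lambda>\<omega>. f (y K \<omega>) - f xs)
      (?D / (\<Sum>i=1..K. \<gamma> * b i)
        + sqrt (\<Sum>i=1..K. (\<gamma> * b i)\<^sup>2 * ?V i) / (\<Sum>i=1..K. \<gamma> * b i))"
    if \<gamma>: "\<gamma> = \<mu> / max L (sqrt (\<Sum>i=1..K. (b i)\<^sup>2 * ?V i))" and b: "\<forall>i\<in>{1..K}. b i > 0"
      and step: "\<forall>i\<in>{1..K}. (\<gamma> * b i)\<^sup>2 / (\<Sum>j=1..i. \<gamma> * b j) \<le> \<gamma>"
      and run: "\<forall>\<omega>\<in>space M. AGD_plus X gf \<psi> g\<psi> x0 (\<lambda>i. \<gamma> * b i) (\<lambda>k. \<eta> k \<omega>)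
        (\<lambda>k. x k \<omega>) (\<lambda>k. y k \<omega>) (\<lambda>k. z k \<omega>)"
    for \<gamma> b x y z
  proof -
    define S where "S = sqrt (\<Sum>i=1..K. (b i)\<^sup>2 * ?V i)"
    let ?Q = "\<Sum>i=1..K. (\<gamma> * b i)\<^sup>2 * ?V i" and ?A = "\<Sum>i=1..K. \<gamma> * b i"
    note r = rate[of S, folded \<gamma>[folded S_def]]
    have A: "0 < ?A" using \<open>K \<ge> 1\<close> r(1) b by (intro sum_pos) auto
    have Q0: "0 \<le> ?Q" by (intro sum_nonneg mult_nonneg_nonneg V) auto
    \<comment> \<open>The root of \<open>?Q\<close> is at most \<open>\<mu>\<close>, so writing
      \<open>?Q\<close> as its square lets one factor cancel the \<open>\<mu>\<close> in the
      denominator.\<close>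
    have "sqrt ?Q = \<gamma> * S"
      unfolding sum_power2_scale S_def using r(1) by (simp add: real_sqrt_mult)
    then have "sqrt ?Q \<le> \<mu>" using r(3) by simp
    then have "sqrt ?Q * sqrt ?Q \<le> \<mu> * sqrt ?Q"
      by (rule mult_right_mono) (rule real_sqrt_ge_zero[OF Q0])
    then have "?Q \<le> \<mu> * sqrt ?Q" using Q0 by simp
    then have "?Q / (\<mu> * ?A) \<le> \<mu> * sqrt ?Q / (\<mu> * ?A)"
      using A \<open>\<mu> > 0\<close> by (intro divide_right_mono) auto
    also have "\<dots> = sqrt ?Q / ?A" using \<open>\<mu> > 0\<close> by simp
    finally show ?thesis
      using core[OF r(1,2) b step run] by (auto elim!: expectation_le_mono)
  qed
  \<comment> \<open>For linear weights \<open>R\<close> is the total weight divided by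
    \<open>\<gamma>\<close> and \<open>T\<close> the Euclidean length of the weight vector;
    \<open>T / R\<close> governs the noise rate.\<close>
  define R T where "R = real K * (real K + 3) / 4" and "T = sqrt (\<Sum>i=1..K. ((real i + 1) / 2)\<^sup>2)"
  have R: "0 < R" using \<open>K \<ge> 1\<close> by (simp add: R_def)
  have T: "0 \<le> T" unfolding T_def by (intro real_sqrt_ge_zero sum_nonneg) auto
  have TR: "T / R \<le> 2 / sqrt (real K)"
    unfolding T_def R_def using \<open>K \<ge> 1\<close> by (rule sqrt_sum_linear_weights_le)
  have DL: "4 * L * ?D / (\<mu> * real K * (real K + 3)) = L * ?D / (\<mu> * R)"
    by (simp add: R_def divide_simps)
  have A: "(\<Sum>i=1..K. \<gamma> * ((real i + 1) / 2)) = \<gamma> * R" for \<gamma>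
    by (simp only: sum_distrib_left[symmetric] sum_linear_weights R_def)
  \<comment> \<open>Dividing by \<open>\<gamma>\<close> multiplies by the maximum, which splits the
    initial-distance term into a smoothness entry and a noise entry.\<close>
  have DA: "?D / (\<mu> / max L S * R) = max (L * ?D / (\<mu> * R)) (S * ?D / (\<mu> * R))" for S
  proof -
    have "?D / (\<mu> / max L S * R) = max L S * (?D / (\<mu> * R))" by simp
    also have "\<dots> = max (L * (?D / (\<mu> * R))) (S * (?D / (\<mu> * R)))"
      using D R \<open>\<mu> > 0\<close> by (intro max_mult_distrib_right[THEN trans]) auto
    finally show ?thesis by simp
  qed
  have weights_pos: "\<forall>i\<in>{1..K}. (real i + 1) / 2 > 0" by auto
  have part2: "expectation_le M (\<lambda>\<omega>. f (y K \<omega>) - f xs)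
      (4 * L * ?D / (\<mu> * real K * (real K + 3)) +
        absolute_const * (\<sigma> * (\<mu> + ?D) / (\<mu> * sqrt (real K))))"
    if \<gamma>: "\<gamma> = \<mu> / max L (sqrt (\<Sum>i=1..K. ((real i + 1) / 2)\<^sup>2 * ?V i))"
      and \<sigma>: "0 \<le> \<sigma>" "\<forall>i\<in>{1..K}. ?V i \<le> \<sigma>\<^sup>2"
      and run: "\<forall>\<omega>\<in>space M. AGD_plus X gf \<psi> g\<psi> x0 (\<lambda>i. \<gamma> * ((real i + 1) / 2)) (\<lambda>k. \<eta> k \<omega>)
        (\<lambda>k. x k \<omega>) (\<lambda>k. y k \<omega>) (\<lambda>k. z k \<omega>)"
    for \<gamma> \<sigma> x y z
  proof -
    define S where "S = sqrt (\<Sum>i=1..K. ((real i + 1) / 2)\<^sup>2 * ?V i)"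
    note \<gamma>S = \<gamma>[folded S_def]
    have \<gamma>_pos: "\<gamma> > 0" unfolding \<gamma>S by (rule rate)
    have S0: "0 \<le> S" unfolding S_def by (intro real_sqrt_ge_zero sum_nonneg mult_nonneg_nonneg V) auto
    have "(\<Sum>i=1..K. ((real i + 1) / 2)\<^sup>2 * ?V i) \<le> (\<Sum>i=1..K. ((real i + 1) / 2)\<^sup>2 * \<sigma>\<^sup>2)"
      using \<sigma>(2) by (intro sum_mono mult_left_mono) auto
    then have "S \<le> sqrt (\<Sum>i=1..K. ((real i + 1) / 2)\<^sup>2 * \<sigma>\<^sup>2)"
      unfolding S_def by (rule real_sqrt_le_mono)
    also have "\<dots> = T * \<sigma>"
      using \<sigma>(1) by (simp add: T_def sum_distrib_right[symmetric] real_sqrt_mult)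
    finally have "S / R \<le> T * \<sigma> / R" using R by (intro divide_right_mono) auto
    also have "\<dots> \<le> 2 / sqrt (real K) * \<sigma>" using mult_right_mono[OF TR \<sigma>(1)] by simp
    finally have SR: "S / R \<le> 2 * \<sigma> / sqrt (real K)" by simp
    have "sqrt (\<Sum>i=1..K. (\<gamma> * ((real i + 1) / 2))\<^sup>2 * ?V i) = \<gamma> * S"
      unfolding sum_power2_scale S_def using \<gamma>_pos by (simp add: real_sqrt_mult)
    then have noise: "sqrt (\<Sum>i=1..K. (\<gamma> * ((real i + 1) / 2))\<^sup>2 * ?V i) / (\<gamma> * R) = S / R"
      using \<gamma>_pos by simp
    have "?D / (\<gamma> * R) = max (L * ?D / (\<mu> * R)) (S * ?D / (\<mu> * R))" unfolding \<gamma>S by (rule DA)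
    \<comment> \<open>A maximum of nonnegative numbers is at most their sum, so the smoothness term
      keeps its exact constant.\<close>
    also have "\<dots> \<le> L * ?D / (\<mu> * R) + S * ?D / (\<mu> * R)"
      using D R S0 \<open>L > 0\<close> \<open>\<mu> > 0\<close> by simp
    also have "S * ?D / (\<mu> * R) = S / R * (?D / \<mu>)" by simp
    also have "\<dots> \<le> 2 * \<sigma> / sqrt (real K) * (?D / \<mu>)"
      using SR D \<open>\<mu> > 0\<close> by (intro mult_right_mono) auto
    finally have "?D / (\<gamma> * R) + S / R
        \<le> L * ?D / (\<mu> * R) + (2 * \<sigma> / sqrt (real K) * (?D / \<mu>) + 2 * \<sigma> / sqrt (real K))"
      using SR by simp
    \<comment> \<open>Both noise contributions share the factor
      \<open>2 * \<sigma> / sqrt (real K)\<close>; the cofactors \<open>?D / \<mu>\<close> and 1 add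
      up to \<open>(\<mu> + ?D) / \<mu>\<close>.\<close>
    also have "2 * \<sigma> / sqrt (real K) * (?D / \<mu>) + 2 * \<sigma> / sqrt (real K)
        = absolute_const * (\<sigma> * (\<mu> + ?D) / (\<mu> * sqrt (real K)))"
      using \<open>\<mu> > 0\<close> \<open>K \<ge> 1\<close> by (simp add: absolute_const_def field_simps)
    finally have bound: "?D / (\<gamma> * R) + S / R \<le> 4 * L * ?D / (\<mu> * real K * (real K + 3))
        + absolute_const * (\<sigma> * (\<mu> + ?D) / (\<mu> * sqrt (real K)))"
      unfolding DL .
    have "\<forall>i\<in>{1..K}. (\<gamma> * ((real i + 1) / 2))\<^sup>2 / (\<Sum>j=1..i. \<gamma> * ((real j + 1) / 2)) \<le> \<gamma>"
      using linear_weights_step[OF \<gamma>_pos] by auto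
    from part1[OF \<gamma> weights_pos this run] bound show ?thesis
      unfolding A noise by (rule expectation_le_mono)
  qed
  have part3: "expectation_le M (\<lambda>\<omega>. f (y K \<omega>) - f xs)
      (absolute_const * (\<sigma>\<^sup>2 / sqrt (real K)) +
        max (4 * L * ?D / (\<mu> * real K * (real K + 3)))
          (absolute_const * (?D / (\<mu> * sqrt (real K)))))"
    if \<gamma>: "\<gamma> = \<mu> / max L (sqrt (\<Sum>i=1..K. ((real i + 1) / 2)\<^sup>2))"
      and \<sigma>: "0 \<le> \<sigma>" "\<forall>i\<in>{1..K}. ?V i \<le> \<sigma>\<^sup>2"
      and run: "\<forall>\<omega>\<in>space M. AGD_plus X gf \<psi> g\<psi> x0 (\<lambda>i. \<gamma> * ((real i + 1) / 2)) (\<lambda>k. \<eta> k \<omega>)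
        (\<lambda>k. x k \<omega>) (\<lambda>k. y k \<omega>) (\<lambda>k. z k \<omega>)"
    for \<gamma> \<sigma> x y z
  proof -
    note \<gamma>T = \<gamma>[folded T_def]
    note r = rate[of T, folded \<gamma>T]
    let ?Q = "\<Sum>i=1..K. (\<gamma> * ((real i + 1) / 2))\<^sup>2 * ?V i"
    have "?Q \<le> (\<Sum>i=1..K. (\<gamma> * ((real i + 1) / 2))\<^sup>2 * \<sigma>\<^sup>2)"
      using \<sigma>(2) by (intro sum_mono mult_left_mono) auto
    also have "\<dots> = \<gamma>\<^sup>2 * (\<Sum>i=1..K. ((real i + 1) / 2)\<^sup>2) * \<sigma>\<^sup>2"
      by (simp only: sum_power2_scale sum_distrib_right mult.assoc)
    \<comment> \<open>One factor \<open>\<gamma> * T\<close> is at most \<open>\<mu>\<close>; the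
      \<open>\<gamma>\<close> in the other cancels against the total weight. Since
      \<open>\<gamma>\<close> is chosen without the variances, \<open>\<sigma>\<close> enters
      squared.\<close>
    also have "\<dots> = (\<gamma> * T) * (\<gamma> * T * \<sigma>\<^sup>2)"
      by (simp add: T_def sum_nonneg power2_eq_square[of \<gamma>] mult_ac)
    also have "\<dots> \<le> \<mu> * (\<gamma> * T * \<sigma>\<^sup>2)"
      using r T by (intro mult_right_mono) auto
    finally have "?Q / (\<mu> * (\<gamma> * R)) \<le> \<mu> * (\<gamma> * T * \<sigma>\<^sup>2) / (\<mu> * (\<gamma> * R))"
      using r(1) R \<open>\<mu> > 0\<close> by (intro divide_right_mono) auto
    also have "\<dots> = T / R * \<sigma>\<^sup>2" using r(1) \<open>\<mu> > 0\<close> by simp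
    also have "\<dots> \<le> 2 / sqrt (real K) * \<sigma>\<^sup>2" using TR by (intro mult_right_mono) auto
    finally have noise: "?Q / (\<mu> * (\<gamma> * R)) \<le> absolute_const * (\<sigma>\<^sup>2 / sqrt (real K))"
      by (simp add: absolute_const_def)
    \<comment> \<open>The maximum from \<open>DA\<close> is kept, and only its second entry is
      estimated.\<close>
    have "T * ?D / (\<mu> * R) = T / R * (?D / \<mu>)" by simp
    also have "\<dots> \<le> 2 / sqrt (real K) * (?D / \<mu>)"
      using TR D \<open>\<mu> > 0\<close> by (intro mult_right_mono) auto
    also have "\<dots> = absolute_const * (?D / (\<mu> * sqrt (real K)))" by (simp add: absolute_const_def)
    finally have "max (L * ?D / (\<mu> * R)) (T * ?D / (\<mu> * R))
        \<le> max (L * ?D / (\<mu> * R)) (absolute_const * (?D / (\<mu> * sqrt (real K))))"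
      by (rule max.mono[OF order_refl])
    then have "?D / (\<gamma> * R) \<le> max (4 * L * ?D / (\<mu> * real K * (real K + 3)))
        (absolute_const * (?D / (\<mu> * sqrt (real K))))"
      unfolding DL \<gamma>T DA .
    with noise have bound: "?D / (\<gamma> * R) + ?Q / (\<mu> * (\<gamma> * R))
        \<le> absolute_const * (\<sigma>\<^sup>2 / sqrt (real K))
          + max (4 * L * ?D / (\<mu> * real K * (real K + 3)))
            (absolute_const * (?D / (\<mu> * sqrt (real K))))"
      by linarith
    have "\<forall>i\<in>{1..K}. (\<gamma> * ((real i + 1) / 2))\<^sup>2 / (\<Sum>j=1..i. \<gamma> * ((real j + 1) / 2)) \<le> \<gamma>"
      using linear_weights_step[OF r(1)] by auto
    from core[OF r(1,2) weights_pos this run] bound show ?thesis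
      unfolding A by (rule expectation_le_mono)
  qed
  show ?thesis
    unfolding Let_def
  proof (intro conjI allI impI, goal_cases)
    case (1 b x y z)
    then show ?case by (rule part1[OF refl])
  next
    case (2 \<sigma> x y z)
    then show ?case by (rule part2[OF refl])
  next
    case (3 \<sigma> x y z)
    then show ?case by (rule part3[OF refl])
  qed
qed

end
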